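(* Let $(M,J,g)$ be a Vaisman manifold and let $\tilde M\to M$ be a Kähler cyclic cover of it, with corresponding Kähler metric $\tilde\omega$. If $\tilde\omega$ has nonnegative quadratic orthogonal bisectional curvature, then $(M,J,g)$ is $Q$-nonnegative.
   Context: A compact Hermitian manifold $(M,J,g)$ with associated form $\omega$ is locally conformally Kähler (LCK) if there is a closed $1$-form $\theta$ (the Lee form) with $d\omega=\theta\wedge\omega$. An LCK manifold is Vaisman if $\nabla^{LC}\theta=0$, where $\nabla^{LC}$ is the Levi-Civita connection of $g$. A Kähler cyclic cover of $(M,J,g)$ is a connected covering $\pi:\tilde M\to M$ with cyclic deck transformation group on which $\pi^*\theta$ is exact, $\pi^*\theta=-df$; the corresponding Kähler metric on $\tilde M$ is $\tilde\omega=e^f\pi^*\omega$, which is well defined up to a positive constant factor. Notation: $n=\dim_{\mathbb{C}}M$; in local holomorphic coordinates, with $g_{i\bar j}$ the metric and $g^{i\bar j}$ its inverse, $\Gamma_{ki}^j=g^{j\bar m}\partial_kg_{i\bar m}$ (Chern connection); $T_{ij}^k=\Gamma_{ij}^k-\Gamma_{ji}^k$, $T_{ij\bar k}=g_{m\bar k}T_{ij}^m$ (Chern torsion); $R_{i\bar jk}{}^{l}=-\partial_{\bar j}\Gamma_{ik}^l$, $R_{i\bar jk\bar l}=g_{m\bar l}R_{i\bar jk}{}^{m}$ (Chern curvature). Define $Q_{i\bar jk\bar l}=R_{i\bar jk\bar l}-g^{p\bar q}T_{kp\bar j}\overline{T_{lq\bar i}}$. A Hermitian manifold is $Q$-nonnegative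 if at every point, in any orthonormal frame of the holomorphic tangent space ($g_{i\bar j}=\delta_{ij}$), and for all real $\lambda_1,\dots,\lambda_n$, $\sum_{k,m=1}^nQ_{m\bar mk\bar k}(\lambda_k^2-\lambda_k\lambda_m)\ge0$. A Kähler metric has nonnegative quadratic orthogonal bisectional curvature if at every point, in any orthonormal frame of the holomorphic tangent space and for all real $\lambda_1,\dots,\lambda_n$, its curvature satisfies $\sum_{k,m=1}^nR_{m\bar mk\bar k}(\lambda_k-\lambda_m)^2\ge0$. *)

theory Defs
  imports "HOL-Analysis.Analysis" "HOL-Algebra.Bij" "HOL-Algebra.Elementary_Groups"
begin

section \<open>Smooth and holomorphic maps on coordinate domains\<close>

text \<open>
  For an open set \<open>S\<close>, \<open>Ck_on k S f\<close> says that \<open>f\<close> is \<open>k\<close> times continuously differentiable on \<open>S\<close>.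
\<close>

primrec Ck_on :: "nat \<Rightarrow> 'x::real_normed_vector set \<Rightarrow> ('x \<Rightarrow> 'y::real_normed_vector) \<Rightarrow> bool" where
  "Ck_on 0 S f \<longleftrightarrow> continuous_on S f"
| "Ck_on (Suc k) S f \<longleftrightarrow>
     (\<forall>x\<in>S. f differentiable (at x)) \<and> (\<forall>v. Ck_on k S (\<lambda>x. frechet_derivative f (at x) v))"

definition smooth_on :: "'x::real_normed_vector set \<Rightarrow> ('x \<Rightarrow> 'y::real_normed_vector) \<Rightarrow> bool" where
  "smooth_on S f \<longleftrightarrow> (\<forall>k. Ck_on k S f)"

text \<open>Holomorphic: real differentiable with complex linear differential.\<close>

definition holomorphic_map_on :: "(complex^'n) set \<Rightarrow> (complex^'n \<Rightarrow> complex^'m) \<Rightarrow> bool" where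
  "holomorphic_map_on S F \<longleftrightarrow>
     (\<forall>z\<in>S. \<exists>L. (F has_derivative L) (at z) \<and> (\<forall>v. L (\<i> *s v) = \<i> *s L v))"


section \<open>Complex manifolds\<close>

text \<open>
  A chart is its domain together with its coordinate map (relevant only on the domain).
  The complex dimension is the cardinality of \<open>'n\<close>.
\<close>

type_synonym ('a, 'n) chart = "'a set \<times> ('a \<Rightarrow> complex^'n)"

abbreviation chart_dom :: "('a, 'n) chart \<Rightarrow> 'a set" where
  "chart_dom c \<equiv> fst c"

definition chart_img :: "('a, 'n) chart \<Rightarrow> (complex^'n) set" where
  "chart_img c = snd c ` fst c"

definition chart_inv :: "('a, 'n) chart \<Rightarrow> complex^'n \<Rightarrow> 'a" where
  "chart_inv c = inv_into (fst c) (snd c)"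

definition transition :: "('a, 'n) chart \<Rightarrow> ('a, 'n) chart \<Rightarrow> complex^'n \<Rightarrow> complex^'n" where
  "transition c c' = snd c' \<circ> chart_inv c"

definition complex_manifold ::
  "'a::{t2_space, second_countable_topology} set \<Rightarrow> ('a, 'n::finite) chart set \<Rightarrow> bool" where
  "complex_manifold M A \<longleftrightarrow>
     (\<Union>c\<in>A. chart_dom c) = M \<and>
     (\<forall>c\<in>A. openin (top_of_set M) (chart_dom c) \<and> open (chart_img c) \<and>
            homeomorphism (chart_dom c) (chart_img c) (snd c) (chart_inv c)) \<and>
     (\<forall>c\<in>A. \<forall>c'\<in>A.
        holomorphic_map_on (snd c ` (chart_dom c \<inter> chart_dom c')) (transition c c'))"


section \<open>Tensor fields\<close>

text \<open>
  A real covariant tensor field is given by its local representatives in the charts of the atlas,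
  subject to the transformation law.  The coordinate space \<open>complex^'n\<close>, viewed as a real vector
  space, is the real tangent space at each point of a chart; there \<open>J\<close> is multiplication
  by \<open>\<i>\<close>.
\<close>

type_synonym 'n form1 = "complex^'n \<Rightarrow> complex^'n \<Rightarrow> real"
type_synonym 'n form2 = "complex^'n \<Rightarrow> complex^'n \<Rightarrow> complex^'n \<Rightarrow> real"

definition one_form :: "('a, 'n::finite) chart set \<Rightarrow> (('a, 'n) chart \<Rightarrow> 'n form1) \<Rightarrow> bool" where
  "one_form A \<theta> \<longleftrightarrow>
     (\<forall>c\<in>A. \<forall>z\<in>chart_img c. linear (\<theta> c z)) \<and>
     (\<forall>c\<in>A. \<forall>v. smooth_on (chart_img c) (\<lambda>z. \<theta> c z v)) \<and>
     (\<forall>c\<in>A. \<forall>c'\<in>A. \<forall>z\<in>snd c ` (chart_dom c \<inter> chart_dom c'). \<forall>v.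
        \<theta> c z v =
        \<theta> c' (transition c c' z) (frechet_derivative (transition c c') (at z) v))"

definition hermitian_metric ::
  "('a, 'n::finite) chart set \<Rightarrow> (('a, 'n) chart \<Rightarrow> 'n form2) \<Rightarrow> bool" where
  "hermitian_metric A g \<longleftrightarrow>
     (\<forall>c\<in>A. \<forall>z\<in>chart_img c. bilinear (g c z) \<and> (\<forall>u v. g c z u v = g c z v u) \<and>
        (\<forall>v. v \<noteq> 0 \<longrightarrow> g c z v v > 0) \<and>
        (\<forall>u v. g c z (\<i> *s u) (\<i> *s v) = g c z u v)) \<and>
     (\<forall>c\<in>A. \<forall>u v. smooth_on (chart_img c) (\<lambda>z. g c z u v)) \<and>
     (\<forall>c\<in>A. \<forall>c'\<in>A. \<forall>z\<in>snd c ` (chart_dom c \<inter> chart_dom c'). \<forall>u v.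
        g c z u v =
        g c' (transition c c' z) (frechet_derivative (transition c c') (at z) u)
                                 (frechet_derivative (transition c c') (at z) v))"

text \<open>Exterior derivatives, evaluated on constant (hence commuting) coordinate vector fields.\<close>

definition ext_deriv1 :: "'n::finite form1 \<Rightarrow> 'n form2" where
  "ext_deriv1 \<alpha> z u v =
     frechet_derivative (\<lambda>x. \<alpha> x v) (at z) u - frechet_derivative (\<lambda>x. \<alpha> x u) (at z) v"

definition ext_deriv2 ::
  "'n::finite form2 \<Rightarrow> complex^'n \<Rightarrow> complex^'n \<Rightarrow> complex^'n \<Rightarrow> complex^'n \<Rightarrow> real" where
  "ext_deriv2 \<beta> z u v w =
     frechet_derivative (\<lambda>x. \<beta> x v w) (at z) u
     - frechet_derivative (\<lambda>x. \<beta> x u w) (at z) v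
     + frechet_derivative (\<lambda>x. \<beta> x u v) (at z) w"

definition wedge12 ::
  "'n::finite form1 \<Rightarrow> 'n form2 \<Rightarrow>
     complex^'n \<Rightarrow> complex^'n \<Rightarrow> complex^'n \<Rightarrow> complex^'n \<Rightarrow> real" where
  "wedge12 \<alpha> \<beta> z u v w = \<alpha> z u * \<beta> z v w - \<alpha> z v * \<beta> z u w + \<alpha> z w * \<beta> z u v"

definition fundamental_form :: "'n::finite form2 \<Rightarrow> 'n form2" where
  "fundamental_form g z u v = g z (\<i> *s u) v"


section \<open>The Levi-Civita connection\<close>

text \<open>
  In a chart a connection is given by its Christoffel map at each point: \<open>\<Gamma> u v\<close> is the covariant
  derivative of the constant field \<open>v\<close> in direction \<open>u\<close>.  The Levi-Civita connection is the
  unique torsion-free metric one; lemma \<open>levi_civita_ex1\<close> below shows that the description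
  is proper.
\<close>

definition torsion_free_metric_at ::
  "'n::finite form2 \<Rightarrow> complex^'n \<Rightarrow> (complex^'n \<Rightarrow> complex^'n \<Rightarrow> complex^'n) \<Rightarrow> bool" where
  "torsion_free_metric_at g z \<Gamma> \<longleftrightarrow>
     bilinear \<Gamma> \<and> (\<forall>u v. \<Gamma> u v = \<Gamma> v u) \<and>
     (\<forall>u v w. frechet_derivative (\<lambda>x. g x v w) (at z) u = g z (\<Gamma> u v) w + g z v (\<Gamma> u w))"

definition levi_civita ::
  "'n::finite form2 \<Rightarrow> complex^'n \<Rightarrow> complex^'n \<Rightarrow> complex^'n \<Rightarrow> complex^'n" where
  "levi_civita g z = (THE \<Gamma>. torsion_free_metric_at g z \<Gamma>)"

definition nabla_LC :: "'n::finite form2 \<Rightarrow> 'n form1 \<Rightarrow> 'n form2" where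
  "nabla_LC g \<alpha> z u v =
     frechet_derivative (\<lambda>x. \<alpha> x v) (at z) u - \<alpha> z (levi_civita g z u v)"


lemma christoffel_ex1:
  fixes G :: "complex^'n::finite \<Rightarrow> complex^'n \<Rightarrow> real"
    and D :: "complex^'n \<Rightarrow> complex^'n \<Rightarrow> complex^'n \<Rightarrow> real"
  assumes G: "bilinear G" and sym: "\<And>u v. G u v = G v u" and pos: "\<And>v. v \<noteq> 0 \<Longrightarrow> G v v > 0"
    and D1: "\<And>v w. linear (\<lambda>u. D u v w)" and D2: "\<And>u w. linear (\<lambda>v. D u v w)"
    and Dsym: "\<And>u v w. D u v w = D u w v"
  shows "\<exists>!\<Gamma>. bilinear \<Gamma> \<and> (\<forall>u v. \<Gamma> u v = \<Gamma> v u) \<and>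
     (\<forall>u v w. D u v w = G (\<Gamma> u v) w + G v (\<Gamma> u w))"
proof -
  have D3: "linear (\<lambda>w. D u v w)" for u v
    by (subst Dsym) (rule D2)
  have Glin: "linear (G a)" for a using G by (simp add: bilinear_def)
  have Glin': "linear (\<lambda>a. G a w)" for w using G by (simp add: bilinear_def)
  define T where "T a = (\<Sum>b\<in>Basis. G a b *\<^sub>R b)" for a
  have T: "T a \<bullet> w = G a w" for a w
  proof -
    have "G a w = G a (\<Sum>b\<in>Basis. (w \<bullet> b) *\<^sub>R b)" by (simp add: euclidean_representation)
    also have "\<dots> = (\<Sum>b\<in>Basis. (w \<bullet> b) * G a b)"
      by (simp add: linear_sum[OF Glin] linear_cmul[OF Glin])
    also have "\<dots> = T a \<bullet> w"
      by (simp add: T_def inner_sum_left inner_commute[of w] mult.commute)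
    finally show ?thesis by simp
  qed
  have linT: "linear T"
    by (rule linearI; rule euclidean_eqI)
       (simp_all only: T inner_add_left inner_scaleR_left linear_add[OF Glin']
          linear_cmul[OF Glin'] real_scaleR_def)
  have eq0: "a = a'" if "\<And>w. G a w = G a' w" for a a'
  proof (rule ccontr)
    assume "a \<noteq> a'"
    then have "G (a - a') (a - a') > 0" by (intro pos) simp
    moreover have "G (a - a') (a - a') = 0"
      by (simp add: linear_diff[OF Glin'] that)
    ultimately show False by simp
  qed
  have "inj T"
  proof (rule injI, rule eq0)
    fix x y w assume "T x = T y"
    then show "G x w = G y w" by (simp flip: T)
  qed
  with linT have "surj T" by (simp add: linear_injective_imp_surjective)
  have riesz: "\<exists>a. \<forall>w. G a w = L w" if "linear L" for L :: "complex^'n \<Rightarrow> real"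
  proof -
    obtain a where a: "T a = (\<Sum>b\<in>Basis. L b *\<^sub>R b)" using \<open>surj T\<close> by (metis surjD)
    have "G a w = L w" for w
    proof -
      have "L w = L (\<Sum>b\<in>Basis. (w \<bullet> b) *\<^sub>R b)" by (simp add: euclidean_representation)
      also have "\<dots> = (\<Sum>b\<in>Basis. (w \<bullet> b) * L b)"
        by (simp add: linear_sum[OF that] linear_cmul[OF that])
      also have "\<dots> = T a \<bullet> w"
        by (simp add: a inner_sum_left inner_commute[of w] mult.commute)
      finally show ?thesis by (simp add: T)
    qed
    then show ?thesis by blast
  qed
  define K where "K u v w = (D u v w + D v u w - D w u v) / 2" for u v w
  have "linear (K u v)" for u v
  proof (intro linearI)
    fix x y r
    show "K u v (x + y) = K u v x + K u v y"
      by (simp only: K_def linear_add[OF D3] linear_add[OF D1]) (simp add: field_simps)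
    show "K u v (r *\<^sub>R x) = r *\<^sub>R K u v x"
      by (simp only: K_def linear_cmul[OF D3] linear_cmul[OF D1]) (simp add: field_simps)
  qed
  note Klin = this
  define \<Gamma> where "\<Gamma> u v = (SOME a. \<forall>w. G a w = K u v w)" for u v
  have \<Gamma>: "G (\<Gamma> u v) w = K u v w" for u v w
    unfolding \<Gamma>_def using someI_ex[OF riesz[OF Klin[of u v]]] by blast
  have \<Gamma>sym: "\<Gamma> u v = \<Gamma> v u" for u v
  proof (rule eq0)
    fix w
    show "G (\<Gamma> u v) w = G (\<Gamma> v u) w"
      using Dsym[of w u v] by (simp only: \<Gamma> K_def) simp
  qed
  have lin: "linear (\<Gamma> u)" for u
  proof (rule linearI; rule eq0)
    fix x y r w
    show "G (\<Gamma> u (x + y)) w = G (\<Gamma> u x + \<Gamma> u y) w"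
      by (simp only: linear_add[OF Glin'] \<Gamma> K_def linear_add[OF D3] linear_add[OF D2]
          linear_add[OF D1]) (simp add: field_simps)
    show "G (\<Gamma> u (r *\<^sub>R x)) w = G (r *\<^sub>R \<Gamma> u x) w"
      by (simp only: linear_cmul[OF Glin'] \<Gamma> K_def linear_cmul[OF D3] linear_cmul[OF D2]
          linear_cmul[OF D1]) (simp add: field_simps)
  qed
  have "bilinear \<Gamma>"
  proof -
    have "linear (\<lambda>u. \<Gamma> u v)" for v
      by (subst \<Gamma>sym) (rule lin)
    then show ?thesis by (simp add: bilinear_def lin)
  qed
  moreover have "D u v w = G (\<Gamma> u v) w + G v (\<Gamma> u w)" for u v w
  proof -
    have "G v (\<Gamma> u w) = K u w v" by (subst sym) (rule \<Gamma>)
    then show ?thesis using Dsym[of u v w] Dsym[of v u w] Dsym[of w u v]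
      by (simp only: \<Gamma> K_def) (simp add: field_simps)
  qed
  moreover have "\<Delta> = \<Gamma>" if "\<forall>u v. \<Delta> u v = \<Delta> v u"
    "\<forall>u v w. D u v w = G (\<Delta> u v) w + G v (\<Delta> u w)" for \<Delta>
  proof (intro ext eq0)
    fix u v w
    note D = that(2)[rule_format]
    have "\<Delta> v u = \<Delta> u v" "\<Delta> w u = \<Delta> u w" "\<Delta> w v = \<Delta> v w"
      by (rule that(1)[rule_format])+
    then have "D u v w = G (\<Delta> u v) w + G v (\<Delta> u w)" "D v u w = G (\<Delta> u v) w + G u (\<Delta> v w)"
      "D w u v = G (\<Delta> u w) v + G u (\<Delta> v w)"
      using D[of u v w] D[of v u w] D[of w u v] by (simp_all only:)
    then show "G (\<Delta> u v) w = G (\<Gamma> u v) w"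
      using sym[of v "\<Delta> u w"] by (simp only: \<Gamma> K_def) simp
  qed
  ultimately show ?thesis using \<Gamma>sym by (intro ex1I[of _ \<Gamma>]) blast+
qed

lemma levi_civita_ex1:
  fixes g :: "('a::{t2_space, second_countable_topology}, 'n::finite) chart \<Rightarrow> 'n form2"
  assumes "complex_manifold M A" "hermitian_metric A g" "c \<in> A" "z \<in> chart_img c"
  shows "\<exists>!\<Gamma>. torsion_free_metric_at (g c) z \<Gamma>"
proof -
  have op: "open (chart_img c)" using assms(1,3) by (auto simp: complex_manifold_def)
  have bil: "bilinear (g c x)" and sym: "\<And>u v. g c x u v = g c x v u" if "x \<in> chart_img c" for x
    using assms(2,3) that by (auto simp: hermitian_metric_def)
  have pos: "v \<noteq> 0 \<Longrightarrow> g c z v v > 0" for v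
    using assms(2-4) by (auto simp: hermitian_metric_def)
  have "smooth_on (chart_img c) (\<lambda>x. g c x v w)" for v w
    using assms(2,3) by (auto simp: hermitian_metric_def)
  then have "Ck_on (Suc 0) (chart_img c) (\<lambda>x. g c x v w)" for v w
    unfolding smooth_on_def by blast
  then have diff: "(\<lambda>x. g c x v w) differentiable (at z)" for v w
    using assms(4) by simp
  define D where "D u v w = frechet_derivative (\<lambda>x. g c x v w) (at z) u" for u v w
  have der: "((\<lambda>x. g c x v w) has_derivative (\<lambda>u. D u v w)) (at z)" for v w
    using diff[of v w] unfolding D_def frechet_derivative_works by simp
  have uniq: "D u v w = F u"
    if "(h has_derivative F) (at z)" "\<And>x. x \<in> chart_img c \<Longrightarrow> h x = g c x v w" for h F u v w
  proof -
    have "((\<lambda>x. g c x v w) has_derivative F) (at z)"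
      by (rule has_derivative_transform_within_open[OF that(1) op assms(4)]) (rule that(2))
    from has_derivative_unique[OF der this] show ?thesis by (rule fun_cong)
  qed
  have "D u (v + v') w = D u v w + D u v' w" for u v v' w
    by (rule uniq[OF has_derivative_add[OF der der]]) (simp add: bilinear_ladd[OF bil])
  moreover have "D u (r *\<^sub>R v) w = r *\<^sub>R D u v w" for u v r w
    by (rule uniq[OF has_derivative_scaleR_right[OF der]])
       (simp add: bilinear_lmul[OF bil])
  ultimately have "linear (\<lambda>v. D u v w)" for u w by (simp add: linear_iff)
  moreover have "linear (\<lambda>u. D u v w)" for v w
    using has_derivative_linear[OF der] .
  moreover have "D u v w = D u w v" for u v w
    by (rule uniq[OF der]) (simp add: sym)
  ultimately show ?thesis
    unfolding torsion_free_metric_at_def D_def[symmetric]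
    using christoffel_ex1[OF bil[OF assms(4)] sym[OF assms(4)] pos, of D] by blast
qed


section \<open>LCK and Vaisman manifolds, and their covers\<close>

definition hermitian_manifold ::
  "'a::{t2_space, second_countable_topology} set \<Rightarrow> ('a, 'n::finite) chart set \<Rightarrow>
     (('a, 'n) chart \<Rightarrow> 'n form2) \<Rightarrow> bool" where
  "hermitian_manifold M A g \<longleftrightarrow> complex_manifold M A \<and> hermitian_metric A g"

definition LCK ::
  "'a::{t2_space, second_countable_topology} set \<Rightarrow> ('a, 'n::finite) chart set \<Rightarrow>
     (('a, 'n) chart \<Rightarrow> 'n form2) \<Rightarrow> (('a, 'n) chart \<Rightarrow> 'n form1) \<Rightarrow> bool" where
  "LCK M A g \<theta> \<longleftrightarrow>
     compact M \<and> hermitian_manifold M A g \<and> one_form A \<theta> \<and>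
     (\<forall>c\<in>A. \<forall>z\<in>chart_img c. \<forall>u v. ext_deriv1 (\<theta> c) z u v = 0) \<and>
     (\<forall>c\<in>A. \<forall>z\<in>chart_img c. \<forall>u v w.
        ext_deriv2 (fundamental_form (g c)) z u v w =
        wedge12 (\<theta> c) (fundamental_form (g c)) z u v w)"

definition Vaisman ::
  "'a::{t2_space, second_countable_topology} set \<Rightarrow> ('a, 'n::finite) chart set \<Rightarrow>
     (('a, 'n) chart \<Rightarrow> 'n form2) \<Rightarrow> (('a, 'n) chart \<Rightarrow> 'n form1) \<Rightarrow> bool" where
  "Vaisman M A g \<theta> \<longleftrightarrow>
     LCK M A g \<theta> \<and>
     (\<forall>c\<in>A. \<forall>z\<in>chart_img c. \<forall>u v. nabla_LC (g c) (\<theta> c) z u v = 0)"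

text \<open>
  The complex structure of a covering \<open>p\<close> from \<open>E\<close> onto \<open>M\<close>: coordinates of \<open>M\<close> composed with \<open>p\<close>
  on the open sets on which \<open>p\<close> is injective.
\<close>

definition cover_atlas ::
  "('a, 'n::finite) chart set \<Rightarrow> 'b::topological_space set \<Rightarrow> ('b \<Rightarrow> 'a) \<Rightarrow> ('b, 'n) chart set" where
  "cover_atlas A E p =
     {(V, snd c \<circ> p) |V c. c \<in> A \<and> openin (top_of_set E) V \<and> p ` V \<subseteq> chart_dom c \<and> inj_on p V}"

text \<open>
  Pullback along \<open>p\<close> in a chart \<open>d\<close> of \<open>E\<close>, computed with some chart of \<open>M\<close> around the image
  point; by the transformation law the choice is irrelevant.
\<close>

definition target_chart ::
  "('a, 'n) chart set \<Rightarrow> ('b \<Rightarrow> 'a) \<Rightarrow> ('b, 'n) chart \<Rightarrow> complex^'n \<Rightarrow> ('a, 'n) chart" where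
  "target_chart A p d z = (SOME c. c \<in> A \<and> p (chart_inv d z) \<in> chart_dom c)"

definition pullback1 ::
  "('a, 'n::finite) chart set \<Rightarrow> ('b \<Rightarrow> 'a) \<Rightarrow> (('a, 'n) chart \<Rightarrow> 'n form1) \<Rightarrow>
     ('b, 'n) chart \<Rightarrow> 'n form1" where
  "pullback1 A p \<theta> d z v =
     (let c = target_chart A p d z; F = snd c \<circ> p \<circ> chart_inv d
      in \<theta> c (F z) (frechet_derivative F (at z) v))"

definition pullback2 ::
  "('a, 'n::finite) chart set \<Rightarrow> ('b \<Rightarrow> 'a) \<Rightarrow> (('a, 'n) chart \<Rightarrow> 'n form2) \<Rightarrow>
     ('b, 'n) chart \<Rightarrow> 'n form2" where
  "pullback2 A p g d z u v =
     (let c = target_chart A p d z; F = snd c \<circ> p \<circ> chart_inv d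
      in g c (F z) (frechet_derivative F (at z) u) (frechet_derivative F (at z) v))"

definition deck_group ::
  "'b::topological_space set \<Rightarrow> ('b \<Rightarrow> 'a) \<Rightarrow> ('b \<Rightarrow> 'b) monoid" where
  "deck_group E p = (BijGroup E)
     \<lparr>carrier := {h \<in> Bij E. homeomorphism E E h (inv_into E h) \<and> (\<forall>x\<in>E. p (h x) = p x)}\<rparr>"

text \<open>\<open>f\<close> is a smooth function on \<open>E\<close> with \<open>p\<^sup>*\<theta> = - df\<close>.\<close>

definition kaehler_cyclic_cover ::
  "'a::{t2_space, second_countable_topology} set \<Rightarrow> ('a, 'n::finite) chart set \<Rightarrow>
     (('a, 'n) chart \<Rightarrow> 'n form1) \<Rightarrow> 'b::topological_space set \<Rightarrow> ('b \<Rightarrow> 'a) \<Rightarrow>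
     ('b \<Rightarrow> real) \<Rightarrow> bool" where
  "kaehler_cyclic_cover M A \<theta> E p f \<longleftrightarrow>
     covering_space E p M \<and> connected E \<and> cyclic_group (deck_group E p) \<and>
     (\<forall>d\<in>cover_atlas A E p. smooth_on (chart_img d) (f \<circ> chart_inv d) \<and>
        (\<forall>z\<in>chart_img d. \<forall>v.
           pullback1 A p \<theta> d z v = - frechet_derivative (f \<circ> chart_inv d) (at z) v))"

definition kaehler_cover_metric ::
  "('a, 'n::finite) chart set \<Rightarrow> (('a, 'n) chart \<Rightarrow> 'n form2) \<Rightarrow> ('b \<Rightarrow> 'a) \<Rightarrow> ('b \<Rightarrow> real) \<Rightarrow>
     ('b, 'n) chart \<Rightarrow> 'n form2" where
  "kaehler_cover_metric A g p f d z u v =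
     exp (f (chart_inv d z)) * pullback2 A p g d z u v"


section \<open>Chern connection, torsion and curvature in holomorphic coordinates\<close>

definition d_hol :: "'n::finite \<Rightarrow> (complex^'n \<Rightarrow> complex) \<Rightarrow> complex^'n \<Rightarrow> complex" where
  "d_hol k h z = (frechet_derivative h (at z) (axis k 1)
                  - \<i> * frechet_derivative h (at z) (axis k \<i>)) / 2"

definition d_antihol :: "'n::finite \<Rightarrow> (complex^'n \<Rightarrow> complex) \<Rightarrow> complex^'n \<Rightarrow> complex" where
  "d_antihol k h z = (frechet_derivative h (at z) (axis k 1)
                      + \<i> * frechet_derivative h (at z) (axis k \<i>)) / 2"

text \<open>
  \<open>gij g z $ i $ j\<close> is the value of the complex bilinear extension of \<open>g\<close> on
  \<open>\<partial>\<^sub>i = (e\<^sub>i - \<i> J e\<^sub>i) / 2\<close> and the conjugate of \<open>\<partial>\<^sub>j\<close>.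
\<close>

definition gij :: "'n::finite form2 \<Rightarrow> complex^'n \<Rightarrow> complex^'n^'n" where
  "gij g z = (\<chi> i j.
     (of_real (g z (axis i 1) (axis j 1)) + of_real (g z (axis i \<i>) (axis j \<i>))
      + \<i> * (of_real (g z (axis i 1) (axis j \<i>)) - of_real (g z (axis i \<i>) (axis j 1)))) / 4)"

text \<open>
  In \<open>gij\<close> the barred index is the column, in the inverse \<open>g_inv\<close> again the second one;
  so the transpose is inverted: \<open>\<Sum>m. g_inv g z $ j $ m * gij g z $ i $ m = (if i = j then 1 else 0)\<close>.
\<close>

definition g_inv :: "'n::finite form2 \<Rightarrow> complex^'n \<Rightarrow> complex^'n^'n" where
  "g_inv g z = matrix_inv (transpose (gij g z))"

definition chern_Gamma ::
  "'n::finite form2 \<Rightarrow> 'n \<Rightarrow> 'n \<Rightarrow> 'n \<Rightarrow> complex^'n \<Rightarrow> complex" where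
  "chern_Gamma g k i j z = (\<Sum>m\<in>UNIV. g_inv g z $ j $ m * d_hol k (\<lambda>x. gij g x $ i $ m) z)"

definition chern_torsion_up ::
  "'n::finite form2 \<Rightarrow> 'n \<Rightarrow> 'n \<Rightarrow> 'n \<Rightarrow> complex^'n \<Rightarrow> complex" where
  "chern_torsion_up g i j k z = chern_Gamma g i j k z - chern_Gamma g j i k z"

definition chern_torsion ::
  "'n::finite form2 \<Rightarrow> 'n \<Rightarrow> 'n \<Rightarrow> 'n \<Rightarrow> complex^'n \<Rightarrow> complex" where
  "chern_torsion g i j k z = (\<Sum>m\<in>UNIV. gij g z $ m $ k * chern_torsion_up g i j m z)"

definition chern_curvature_up ::
  "'n::finite form2 \<Rightarrow> 'n \<Rightarrow> 'n \<Rightarrow> 'n \<Rightarrow> 'n \<Rightarrow> complex^'n \<Rightarrow> complex" where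
  "chern_curvature_up g i j k l z = - d_antihol j (chern_Gamma g i k l) z"

text \<open>In the following four-index tensors the second and the fourth index are barred.\<close>

definition chern_curvature ::
  "'n::finite form2 \<Rightarrow> complex^'n \<Rightarrow> 'n \<Rightarrow> 'n \<Rightarrow> 'n \<Rightarrow> 'n \<Rightarrow> complex" where
  "chern_curvature g z i j k l = (\<Sum>m\<in>UNIV. gij g z $ m $ l * chern_curvature_up g i j k m z)"

definition Q_tensor ::
  "'n::finite form2 \<Rightarrow> complex^'n \<Rightarrow> 'n \<Rightarrow> 'n \<Rightarrow> 'n \<Rightarrow> 'n \<Rightarrow> complex" where
  "Q_tensor g z i j k l = chern_curvature g z i j k l
     - (\<Sum>p\<in>UNIV. \<Sum>q\<in>UNIV.
          g_inv g z $ p $ q * chern_torsion g k p j z * cnj (chern_torsion g l q i z))"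

text \<open>
  A frame of the holomorphic tangent space at a point: \<open>e a\<close> stands for \<open>\<Sum>i. e a $ i * \<partial>\<^sub>i\<close>.
\<close>

definition orthonormal_frame :: "'n::finite form2 \<Rightarrow> complex^'n \<Rightarrow> ('n \<Rightarrow> complex^'n) \<Rightarrow> bool" where
  "orthonormal_frame g z e \<longleftrightarrow>
     (\<forall>a b. (\<Sum>i\<in>UNIV. \<Sum>j\<in>UNIV. gij g z $ i $ j * e a $ i * cnj (e b $ j)) =
            (if a = b then 1 else 0))"

definition in_frame ::
  "('n::finite \<Rightarrow> 'n \<Rightarrow> 'n \<Rightarrow> 'n \<Rightarrow> complex) \<Rightarrow> ('n \<Rightarrow> complex^'n) \<Rightarrow>
     'n \<Rightarrow> 'n \<Rightarrow> 'n \<Rightarrow> 'n \<Rightarrow> complex" where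
  "in_frame X e a b c d =
     (\<Sum>i\<in>UNIV. \<Sum>j\<in>UNIV. \<Sum>k\<in>UNIV. \<Sum>l\<in>UNIV.
        X i j k l * e a $ i * cnj (e b $ j) * e c $ k * cnj (e d $ l))"

text \<open>
  The diagonal values \<open>m, m, k, k\<close> of both tensors are real by the Hermitian symmetry of the
  Chern curvature; taking \<open>Re\<close> only changes the type.
\<close>

definition Q_nonnegative ::
  "('a, 'n::finite) chart set \<Rightarrow> (('a, 'n) chart \<Rightarrow> 'n form2) \<Rightarrow> bool" where
  "Q_nonnegative A g \<longleftrightarrow>
     (\<forall>c\<in>A. \<forall>z\<in>chart_img c. \<forall>e. orthonormal_frame (g c) z e \<longrightarrow>
        (\<forall>l :: 'n \<Rightarrow> real.
           (\<Sum>k\<in>UNIV. \<Sum>m\<in>UNIV.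
              Re (in_frame (Q_tensor (g c) z) e m m k k) * ((l k)\<^sup>2 - l k * l m)) \<ge> 0))"

text \<open>The curvature of a Kaehler metric is its Chern curvature.\<close>

definition nonneg_quadratic_orth_bisectional ::
  "('a, 'n::finite) chart set \<Rightarrow> (('a, 'n) chart \<Rightarrow> 'n form2) \<Rightarrow> bool" where
  "nonneg_quadratic_orth_bisectional A g \<longleftrightarrow>
     (\<forall>c\<in>A. \<forall>z\<in>chart_img c. \<forall>e. orthonormal_frame (g c) z e \<longrightarrow>
        (\<forall>l :: 'n \<Rightarrow> real.
           (\<Sum>k\<in>UNIV. \<Sum>m\<in>UNIV.
              Re (in_frame (chern_curvature (g c) z) e m m k k) * (l k - l m)\<^sup>2) \<ge> 0))"

end

theory Submission
  imports Defs
begin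

text \<open>
  On a small open set of the cover, which we identify with an open set of a chart of \<open>M\<close>, write
  \<open>\<theta> = - dh\<close>, so that \<open>e\<^sup>h g\<close> is the given Kaehler metric, with curvature \<open>K\<close>; indices of \<open>h\<close> are
  coordinate derivatives.  The LCK identity says that \<open>g\<close> has the Chern torsion
  \<open>T\<^sub>i\<^sub>j\<^sub>k = - h\<^sub>i g\<^sub>j\<^sub>k + h\<^sub>j g\<^sub>i\<^sub>k\<close> (third index barred), and the curvature of \<open>g\<close> is \<open>e\<^sup>-\<^sup>h K\<close> plus the
  complex Hessian of \<open>h\<close> times \<open>g\<close>.  If \<open>\<theta>\<close> is parallel, the Koszul formula and the LCK identity give
  the complex Hessian of \<open>h\<close> as \<open>S g - \<partial>h \<otimes> cnj (\<partial>h)\<close>, where \<open>2 S\<close> is the squared norm of \<open>dh\<close>.  Hence, for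
  \<open>m \<noteq> k\<close> in an orthonormal frame in which \<open>\<partial>h\<close> has components \<open>\<phi>\<close>,
  \<open>Q\<^sub>m\<^sub>m\<^sub>k\<^sub>k = e\<^sup>-\<^sup>h K\<^sub>m\<^sub>m\<^sub>k\<^sub>k + (S - \<bar>\<phi>\<^sub>m\<bar>\<^sup>2 - \<bar>\<phi>\<^sub>k\<bar>\<^sup>2)\<close>.
  The coefficients with \<open>m = k\<close> do not enter the \<open>Q\<close>-form, and both summands are symmetric in \<open>m\<close> and
  \<open>k\<close>, which turns \<open>\<lambda>\<^sub>k\<^sup>2 - \<lambda>\<^sub>k \<lambda>\<^sub>m\<close> into \<open>(\<lambda>\<^sub>k - \<lambda>\<^sub>m)\<^sup>2 / 2\<close>.  The first summand is then nonnegative by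
  hypothesis, the second by Bessel's inequality.
\<close>

section \<open>Functions of class \<open>C\<^sup>k\<close> and second derivatives\<close>

text \<open>\<open>frechet_derivative\<close> at a point of \<open>S\<close> looks at a full
  neighbourhood, so it is the openness of \<open>S\<close> that lets the values on \<open>S\<close>
  determine it.\<close>

lemma Ck_on_cong:
  assumes "open S" "Ck_on k S f" "\<And>x. x \<in> S \<Longrightarrow> f x = g x"
  shows "Ck_on k S g"
  using assms(2,3)
proof (induction k arbitrary: f g)
  case 0
  then show ?case using continuous_on_cong by force
next
  case (Suc k)
  have "f differentiable at x" if "x \<in> S" for x using Suc.prems that by simp
  then have D: "(g has_derivative frechet_derivative f (at x)) (at x)" if "x \<in> S" for x
    using that Suc.prems(2) \<open>open S\<close> frechet_derivative_works has_derivative_transform_within_open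
    by metis
  then have "frechet_derivative f (at x) = frechet_derivative g (at x)" if "x \<in> S" for x
    using that frechet_derivative_at by blast
  then have "Ck_on k S (\<lambda>x. frechet_derivative g (at x) v)" for v
    using Suc.IH[of "\<lambda>x. frechet_derivative f (at x) v"] Suc.prems(1) by simp
  then show ?case using D by (auto simp: differentiable_def)
qed

text \<open>Product and chain rules leave undifferentiated factors, which the inductions below need
  one order lower.\<close>

lemma Ck_on_Suc_imp_Ck_on: "Ck_on (Suc k) S f \<Longrightarrow> Ck_on k S f"
proof (induction k arbitrary: f)
  case 0
  then show ?case
    by (auto intro!: continuous_at_imp_continuous_on differentiable_imp_continuous_within)
next
  case (Suc k)
  then show ?case by simp
qed

lemma Ck_on_add:
  assumes "open S" "Ck_on k S f" "Ck_on k S g"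
  shows "Ck_on k S (\<lambda>x. f x + g x)"
  using assms(2,3)
proof (induction k arbitrary: f g)
  case 0
  then show ?case by (auto intro: continuous_on_add)
next
  case (Suc k)
  have D: "((\<lambda>x. f x + g x) has_derivative (\<lambda>v. frechet_derivative f (at x) v
      + frechet_derivative g (at x) v)) (at x)" if "x \<in> S" for x
    using Suc.prems that by (intro has_derivative_add) (auto simp flip: frechet_derivative_works)
  have *: "frechet_derivative (\<lambda>x. f x + g x) (at x) v =
      frechet_derivative f (at x) v + frechet_derivative g (at x) v" if "x \<in> S" for x v
    using frechet_derivative_at[OF D[OF that]] by metis
  have "Ck_on k S (\<lambda>x. frechet_derivative f (at x) v + frechet_derivative g (at x) v)" for v
    using Suc by simp
  then have "Ck_on k S (\<lambda>x. frechet_derivative (\<lambda>x. f x + g x) (at x) v)" for v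
    by (rule Ck_on_cong[OF \<open>open S\<close>]) (simp add: *)
  with D show ?case by (auto simp: differentiable_def)
qed

lemma Ck_on_bounded_linear:
  assumes "open S" "Ck_on k S f" "bounded_linear L"
  shows "Ck_on k S (\<lambda>x. L (f x))"
  using assms(2)
proof (induction k arbitrary: f)
  case 0
  then show ?case using assms(3) by (auto intro: linear_continuous_on_compose bounded_linear.continuous_on)
next
  case (Suc k)
  have D: "((\<lambda>x. L (f x)) has_derivative (\<lambda>v. L (frechet_derivative f (at x) v))) (at x)"
    if "x \<in> S" for x
    using Suc.prems that bounded_linear.has_derivative[OF assms(3)] frechet_derivative_works
    by (metis Ck_on.simps(2))
  then have *: "frechet_derivative (\<lambda>x. L (f x)) (at x) v = L (frechet_derivative f (at x) v)"
    if "x \<in> S" for x v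
    using frechet_derivative_at[OF D[OF that]] by metis
  have "Ck_on k S (\<lambda>x. L (frechet_derivative f (at x) v))" for v
    using Suc by simp
  then have "Ck_on k S (\<lambda>x. frechet_derivative (\<lambda>x. L (f x)) (at x) v)" for v
    by (rule Ck_on_cong[OF \<open>open S\<close>]) (simp add: *)
  with D show ?case by (auto simp: differentiable_def)
qed

lemma Ck_on_mult:
  fixes f g :: "'x::real_normed_vector \<Rightarrow> 'y::real_normed_algebra"
  assumes "open S" "Ck_on k S f" "Ck_on k S g"
  shows "Ck_on k S (\<lambda>x. f x * g x)"
  using assms(2,3)
proof (induction k arbitrary: f g)
  case 0
  then show ?case by (auto intro: continuous_on_mult)
next
  case (Suc k)
  have D: "((\<lambda>x. f x * g x) has_derivative (\<lambda>v. f x * frechet_derivative g (at x) v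
      + frechet_derivative f (at x) v * g x)) (at x)" if "x \<in> S" for x
    using Suc.prems that by (intro has_derivative_mult) (auto simp flip: frechet_derivative_works)
  have *: "frechet_derivative (\<lambda>x. f x * g x) (at x) v =
      f x * frechet_derivative g (at x) v + frechet_derivative f (at x) v * g x"
    if "x \<in> S" for x v
    using frechet_derivative_at[OF D[OF that]] by metis
  have "Ck_on k S (\<lambda>x. f x * frechet_derivative g (at x) v + frechet_derivative f (at x) v * g x)" for v
    using Suc.prems Ck_on_Suc_imp_Ck_on[OF Suc.prems(1)] Ck_on_Suc_imp_Ck_on[OF Suc.prems(2)]
    by (intro Ck_on_add[OF \<open>open S\<close>] Suc.IH) simp_all
  then have "Ck_on k S (\<lambda>x. frechet_derivative (\<lambda>x. f x * g x) (at x) v)" for v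
    by (rule Ck_on_cong[OF \<open>open S\<close>]) (simp add: *)
  with D show ?case by (auto simp: differentiable_def)
qed

lemma Ck_on_exp:
  fixes f :: "'x::real_normed_vector \<Rightarrow> real"
  assumes "open S" "Ck_on k S f"
  shows "Ck_on k S (\<lambda>x. exp (f x))"
  using assms(2)
proof (induction k)
  case 0
  then show ?case by (auto intro: continuous_on_exp)
next
  case (Suc k)
  have D: "((\<lambda>x. exp (f x)) has_derivative (\<lambda>v. exp (f x) * frechet_derivative f (at x) v)) (at x)"
    if "x \<in> S" for x
  proof -
    have "(f has_derivative frechet_derivative f (at x)) (at x)"
      using Suc.prems that by (simp flip: frechet_derivative_works)
    from has_derivative_exp[OF this] show ?thesis by (simp add: mult.commute)
  qed
  have *: "frechet_derivative (\<lambda>x. exp (f x)) (at x) v = exp (f x) * frechet_derivative f (at x) v"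
    if "x \<in> S" for x v
    using frechet_derivative_at[OF D[OF that]] by metis
  have "Ck_on k S (\<lambda>x. exp (f x))" by (rule Suc.IH[OF Ck_on_Suc_imp_Ck_on[OF Suc.prems]])
  then have "Ck_on k S (\<lambda>x. exp (f x) * frechet_derivative f (at x) v)" for v
    using Suc.prems by (intro Ck_on_mult[OF \<open>open S\<close>]) auto
  then have "Ck_on k S (\<lambda>x. frechet_derivative (\<lambda>x. exp (f x)) (at x) v)" for v
    by (rule Ck_on_cong[OF \<open>open S\<close>]) (simp add: *)
  with D show ?case by (auto simp: differentiable_def)
qed

section \<open>Symmetry of second derivatives\<close>

text \<open>Two applications of the mean value theorem: along \<open>u\<close> to the increment of
  \<open>f\<close> by \<open>s *\<^sub>R v\<close>, then along \<open>v\<close> to the derivative of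
  \<open>f\<close> in direction \<open>u\<close>.\<close>

lemma second_difference_mvt:
  fixes f :: "'a::real_normed_vector \<Rightarrow> real"
  assumes s: "s > 0"
    and sub: "\<And>a b. \<lbrakk>0 \<le> a; a \<le> s; 0 \<le> b; b \<le> s\<rbrakk> \<Longrightarrow> z + a *\<^sub>R u + b *\<^sub>R v \<in> S"
    and f: "\<And>x. x \<in> S \<Longrightarrow> f differentiable at x"
    and Df: "\<And>x. x \<in> S \<Longrightarrow> (\<lambda>x. frechet_derivative f (at x) u) differentiable at x"
  shows "\<exists>\<xi> \<eta>. 0 \<le> \<xi> \<and> \<xi> \<le> s \<and> 0 \<le> \<eta> \<and> \<eta> \<le> s \<and>
    f (z + s *\<^sub>R u + s *\<^sub>R v) - f (z + s *\<^sub>R u) - f (z + s *\<^sub>R v) + f z =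
    s\<^sup>2 * frechet_derivative (\<lambda>x. frechet_derivative f (at x) u) (at (z + \<xi> *\<^sub>R u + \<eta> *\<^sub>R v)) v"
proof -
  have line: "((\<lambda>a. F (y + a *\<^sub>R w)) has_real_derivative frechet_derivative F (at (y + a *\<^sub>R w)) w) (at a)"
    if "F differentiable at (y + a *\<^sub>R w)" for F :: "'a \<Rightarrow> real" and y w a
  proof -
    have lin: "linear (frechet_derivative F (at (y + a *\<^sub>R w)))"
      using that by (rule linear_frechet_derivative)
    have "((\<lambda>a. y + a *\<^sub>R w) has_derivative (\<lambda>t. t *\<^sub>R w)) (at a)"
      by (auto intro!: derivative_eq_intros)
    moreover have "(F has_derivative frechet_derivative F (at (y + a *\<^sub>R w))) (at (y + a *\<^sub>R w))"
      using that frechet_derivative_works by blast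
    ultimately have "((\<lambda>a. F (y + a *\<^sub>R w)) has_derivative
        (\<lambda>t. frechet_derivative F (at (y + a *\<^sub>R w)) (t *\<^sub>R w))) (at a)"
      by (rule has_derivative_compose)
    then show ?thesis
      by (simp add: has_field_derivative_def linear_cmul[OF lin] mult.commute[of _ "frechet_derivative F (at (y + a *\<^sub>R w)) w"])
  qed
  define \<phi> where "\<phi> a = f ((z + s *\<^sub>R v) + a *\<^sub>R u) - f (z + a *\<^sub>R u)" for a
  have "\<exists>\<xi>. 0 < \<xi> \<and> \<xi> < s \<and> \<phi> s - \<phi> 0 = (s - 0) *
     (frechet_derivative f (at ((z + s *\<^sub>R v) + \<xi> *\<^sub>R u)) u - frechet_derivative f (at (z + \<xi> *\<^sub>R u)) u)"
  proof (rule MVT2[OF s])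
    fix a assume a: "0 \<le> a" "a \<le> s"
    have "z + s *\<^sub>R v + a *\<^sub>R u \<in> S" "z + a *\<^sub>R u \<in> S"
      using sub[of a s] sub[of a 0] a s by (auto simp: algebra_simps)
    then show "DERIV \<phi> a :> frechet_derivative f (at ((z + s *\<^sub>R v) + a *\<^sub>R u)) u
        - frechet_derivative f (at (z + a *\<^sub>R u)) u"
      unfolding \<phi>_def by (intro DERIV_diff line f)
  qed
  then obtain \<xi> where \<xi>: "0 < \<xi>" "\<xi> < s" and 1: "\<phi> s - \<phi> 0 = s *
     (frechet_derivative f (at ((z + s *\<^sub>R v) + \<xi> *\<^sub>R u)) u - frechet_derivative f (at (z + \<xi> *\<^sub>R u)) u)"
    by auto
  define \<psi> where "\<psi> b = frechet_derivative f (at ((z + \<xi> *\<^sub>R u) + b *\<^sub>R v)) u" for b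
  have "\<exists>\<eta>. 0 < \<eta> \<and> \<eta> < s \<and> \<psi> s - \<psi> 0 = (s - 0) *
     frechet_derivative (\<lambda>x. frechet_derivative f (at x) u) (at (z + \<xi> *\<^sub>R u + \<eta> *\<^sub>R v)) v"
  proof (rule MVT2[OF s])
    fix b assume b: "0 \<le> b" "b \<le> s"
    then show "DERIV \<psi> b :>
       frechet_derivative (\<lambda>x. frechet_derivative f (at x) u) (at (z + \<xi> *\<^sub>R u + b *\<^sub>R v)) v"
      unfolding \<psi>_def using \<xi> by (intro line Df sub) auto
  qed
  then obtain \<eta> where \<eta>: "0 < \<eta>" "\<eta> < s" and 2: "\<psi> s - \<psi> 0 = s *
     frechet_derivative (\<lambda>x. frechet_derivative f (at x) u) (at (z + \<xi> *\<^sub>R u + \<eta> *\<^sub>R v)) v"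
    by auto
  have "f (z + s *\<^sub>R u + s *\<^sub>R v) - f (z + s *\<^sub>R u) - f (z + s *\<^sub>R v) + f z = \<phi> s - \<phi> 0"
    by (simp add: \<phi>_def algebra_simps)
  also have "\<dots> = s * (\<psi> s - \<psi> 0)"
    using 1 by (simp add: \<psi>_def algebra_simps)
  also have "\<dots> = s\<^sup>2 *
      frechet_derivative (\<lambda>x. frechet_derivative f (at x) u) (at (z + \<xi> *\<^sub>R u + \<eta> *\<^sub>R v)) v"
    by (simp add: 2 power2_eq_square)
  finally show ?thesis using \<xi> \<eta> by (intro exI[of _ \<xi>] exI[of _ \<eta>]) simp
qed

text \<open>The second difference over the parallelogram spanned by \<open>s *\<^sub>R u\<close> and
  \<open>s *\<^sub>R v\<close> is symmetric in \<open>u\<close> and \<open>v\<close>. So a value of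
  one mixed derivative near \<open>z\<close> equals a value of the other near \<open>z\<close>, and
  continuity carries this to \<open>z\<close>.\<close>

lemma frechet_derivative_commute_real:
  fixes f :: "'a::real_normed_vector \<Rightarrow> real"
  assumes "open S" "z \<in> S" "Ck_on 2 S f"
  shows "frechet_derivative (\<lambda>x. frechet_derivative f (at x) u) (at z) v =
         frechet_derivative (\<lambda>x. frechet_derivative f (at x) v) (at z) u"
proof (rule ccontr)
  define D where "D u v x = frechet_derivative (\<lambda>x. frechet_derivative f (at x) u) (at x) v" for u v x
  assume "\<not> ?thesis"
  then have "D u v z \<noteq> D v u z" by (simp add: D_def)
  \<comment> \<open>Half the supposed gap: two errors below it cannot bridge the gap.\<close>
  define \<epsilon> where "\<epsilon> = \<bar>D u v z - D v u z\<bar> / 2"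
  have "\<epsilon> > 0" using \<open>D u v z \<noteq> D v u z\<close> by (simp add: \<epsilon>_def)
  have f: "f differentiable at x" and Df: "(\<lambda>x. frechet_derivative f (at x) w) differentiable at x"
    if "x \<in> S" for x w
    using assms(3) that by (auto simp: eval_nat_numeral)
  have cont: "continuous_on S (D w w')" for w w'
    using assms(3) by (auto simp: eval_nat_numeral D_def)
  have "\<exists>\<delta>>0. \<forall>y\<in>S. dist y z < \<delta> \<longrightarrow> dist (D w w' y) (D w w' z) < \<epsilon>" for w w'
    using cont[of w w'] \<open>z \<in> S\<close> \<open>\<epsilon> > 0\<close> unfolding continuous_on_iff by blast
  then obtain d1 d2 where d1: "d1 > 0" "\<And>y. \<lbrakk>y \<in> S; dist y z < d1\<rbrakk> \<Longrightarrow> dist (D u v y) (D u v z) < \<epsilon>"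
    and d2: "d2 > 0" "\<And>y. \<lbrakk>y \<in> S; dist y z < d2\<rbrakk> \<Longrightarrow> dist (D v u y) (D v u z) < \<epsilon>"
    by metis
  obtain d3 where d3: "d3 > 0" "\<And>y. dist y z < d3 \<Longrightarrow> y \<in> S"
    using \<open>open S\<close> \<open>z \<in> S\<close> by (auto simp: open_dist)
  define d where "d = min d1 (min d2 d3)"
  have d: "d > 0" using d1 d2 d3 by (simp add: d_def)
  \<comment> \<open>Keeps the whole parallelogram within distance \<open>d\<close> of
    \<open>z\<close>; the summand 1 keeps the denominator positive even for
    \<open>u = v = 0\<close>.\<close>
  define s where "s = d / (norm u + norm v + 1)"
  have s: "s > 0" using d by (simp add: s_def add_nonneg_pos)
  have near: "dist (z + a *\<^sub>R u + b *\<^sub>R v) z < d" if "0 \<le> a" "a \<le> s" "0 \<le> b" "b \<le> s" for a b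
  proof -
    have "dist (z + a *\<^sub>R u + b *\<^sub>R v) z = norm (a *\<^sub>R u + b *\<^sub>R v)"
      by (simp add: dist_norm algebra_simps)
    also have "\<dots> \<le> a * norm u + b * norm v"
      using norm_triangle_ineq[of "a *\<^sub>R u" "b *\<^sub>R v"] that by simp
    also have "\<dots> \<le> s * norm u + s * norm v"
      using that by (intro add_mono mult_right_mono) auto
    also have "\<dots> < s * (norm u + norm v + 1)" using s by (simp add: algebra_simps)
    also have "\<dots> = d"
      unfolding s_def using add_nonneg_pos[of "norm u + norm v" 1] by (simp add: less_imp_neq)
    finally show ?thesis .
  qed
  have inS: "z + a *\<^sub>R u + b *\<^sub>R v \<in> S" if "0 \<le> a" "a \<le> s" "0 \<le> b" "b \<le> s" for a b
    using near[OF that] d3(2) by (simp add: d_def)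
  have inS': "z + a *\<^sub>R v + b *\<^sub>R u \<in> S" if "0 \<le> a" "a \<le> s" "0 \<le> b" "b \<le> s" for a b
    using inS[OF that(3,4,1,2)] by (simp add: algebra_simps)
  obtain a b where ab: "0 \<le> a" "a \<le> s" "0 \<le> b" "b \<le> s"
    and eq1: "f (z + s *\<^sub>R u + s *\<^sub>R v) - f (z + s *\<^sub>R u) - f (z + s *\<^sub>R v) + f z =
      s\<^sup>2 * D u v (z + a *\<^sub>R u + b *\<^sub>R v)"
    using second_difference_mvt[OF s inS f Df] unfolding D_def by blast
  obtain a' b' where ab': "0 \<le> a'" "a' \<le> s" "0 \<le> b'" "b' \<le> s"
    and eq2: "f (z + s *\<^sub>R v + s *\<^sub>R u) - f (z + s *\<^sub>R v) - f (z + s *\<^sub>R u) + f z =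
      s\<^sup>2 * D v u (z + a' *\<^sub>R v + b' *\<^sub>R u)"
    using second_difference_mvt[OF s inS' f Df] unfolding D_def by blast
  have "s\<^sup>2 * D u v (z + a *\<^sub>R u + b *\<^sub>R v) = s\<^sup>2 * D v u (z + b' *\<^sub>R u + a' *\<^sub>R v)"
    using eq1 eq2 by (simp add: algebra_simps)
  then have "D u v (z + a *\<^sub>R u + b *\<^sub>R v) = D v u (z + b' *\<^sub>R u + a' *\<^sub>R v)"
    using s by simp
  moreover have "dist (D u v (z + a *\<^sub>R u + b *\<^sub>R v)) (D u v z) < \<epsilon>"
    using d1(2) inS[OF ab] near[OF ab] by (simp add: d_def)
  moreover have "dist (D v u (z + b' *\<^sub>R u + a' *\<^sub>R v)) (D v u z) < \<epsilon>"
    using d2(2) inS[OF ab'(3,4,1,2)] near[OF ab'(3,4,1,2)] by (simp add: d_def)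
  ultimately have "\<bar>D u v z - D v u z\<bar> < 2 * \<epsilon>" unfolding dist_real_def by linarith
  then show False by (simp add: \<epsilon>_def)
qed

text \<open>Inner products with basis vectors commute with differentiation, which reduces the claim
  to real components.\<close>

lemma frechet_derivative_commute:
  fixes f :: "'a::real_normed_vector \<Rightarrow> 'b::euclidean_space"
  assumes "open S" "z \<in> S" "Ck_on 2 S f"
  shows "frechet_derivative (\<lambda>x. frechet_derivative f (at x) u) (at z) v =
         frechet_derivative (\<lambda>x. frechet_derivative f (at x) v) (at z) u"
proof (rule euclidean_eqI)
  fix b :: 'b assume "b \<in> Basis"
  have f: "f differentiable at x" and Df: "(\<lambda>x. frechet_derivative f (at x) w) differentiable at x"
    if "x \<in> S" for x w
    using assms(3) that by (auto simp: eval_nat_numeral)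
  have inner: "((\<lambda>x. F x \<bullet> b) has_derivative (\<lambda>v. frechet_derivative F (at x) v \<bullet> b)) (at x)"
    if "F differentiable at x" for F :: "'a \<Rightarrow> 'b" and x
    using that by (intro has_derivative_inner_left) (simp flip: frechet_derivative_works)
  have 1: "frechet_derivative (\<lambda>x. f x \<bullet> b) (at x) w = frechet_derivative f (at x) w \<bullet> b"
    if "x \<in> S" for x w
    using frechet_derivative_at[OF inner[OF f[OF that]]] by metis
  have 2: "frechet_derivative (\<lambda>x. frechet_derivative (\<lambda>x. f x \<bullet> b) (at x) w) (at z) w' =
      frechet_derivative (\<lambda>x. frechet_derivative f (at x) w) (at z) w' \<bullet> b" for w w'
  proof -
    have "((\<lambda>x. frechet_derivative (\<lambda>x. f x \<bullet> b) (at x) w) has_derivative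
       (\<lambda>v. frechet_derivative (\<lambda>x. frechet_derivative f (at x) w) (at z) v \<bullet> b)) (at z)"
      by (rule has_derivative_transform_within_open[OF inner[OF Df[OF assms(2)]] assms(1,2)])
        (simp add: 1)
    from frechet_derivative_at[OF this] show ?thesis by metis
  qed
  have "Ck_on 2 S (\<lambda>x. f x \<bullet> b)"
    using assms by (intro Ck_on_bounded_linear[where L = "\<lambda>y. y \<bullet> b"] bounded_linear_inner_left)
  from frechet_derivative_commute_real[OF assms(1,2) this, of u v]
  show "frechet_derivative (\<lambda>x. frechet_derivative f (at x) u) (at z) v \<bullet> b =
         frechet_derivative (\<lambda>x. frechet_derivative f (at x) v) (at z) u \<bullet> b"
    by (simp add: 2)
qed

section \<open>Wirtinger derivatives\<close>

lemma frechet_derivative_cong_open: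
  assumes "open S" "z \<in> S" "\<And>x. x \<in> S \<Longrightarrow> f x = g x"
  shows "frechet_derivative f (at z) = frechet_derivative g (at z)"
proof -
  have "(f has_derivative D) (at z) \<longleftrightarrow> (g has_derivative D) (at z)" for D
    using has_derivative_transform_within_open[OF _ assms(1,2)] assms(3) by metis
  then show ?thesis by (simp add: frechet_derivative_def)
qed

text \<open>
  Treating \<open>\<partial>\<^sub>k\<close> (\<open>a = - \<i>\<close>) and its conjugate (\<open>a = \<i>\<close>) as one operator.
\<close>

definition wirtinger :: "complex \<Rightarrow> 'n::finite \<Rightarrow> (complex^'n \<Rightarrow> complex) \<Rightarrow> complex^'n \<Rightarrow> complex" where
  "wirtinger a k F z =
     (frechet_derivative F (at z) (axis k 1) + a * frechet_derivative F (at z) (axis k \<i>)) / 2"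

lemma d_hol_wirtinger: "d_hol = wirtinger (- \<i>)"
  by (intro ext) (simp add: d_hol_def wirtinger_def)

lemma d_antihol_wirtinger: "d_antihol = wirtinger \<i>"
  by (intro ext) (simp add: d_antihol_def wirtinger_def)

lemma wirtinger_has_derivative:
  assumes "(F has_derivative F') (at z)"
  shows "wirtinger a k F z = (F' (axis k 1) + a * F' (axis k \<i>)) / 2"
  using frechet_derivative_at[OF assms] by (simp add: wirtinger_def)

lemma wirtinger_cong:
  assumes "open S" "z \<in> S" "\<And>x. x \<in> S \<Longrightarrow> F x = G x"
  shows "wirtinger a k F z = wirtinger a k G z"
  unfolding wirtinger_def using frechet_derivative_cong_open[OF assms] by simp

lemma wirtinger_const: "wirtinger a k (\<lambda>x. c) z = 0"
  by (simp add: wirtinger_def)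

lemma wirtinger_add:
  assumes "F differentiable at z" "G differentiable at z"
  shows "wirtinger a k (\<lambda>x. F x + G x) z = wirtinger a k F z + wirtinger a k G z"
  unfolding wirtinger_has_derivative[OF has_derivative_add[OF assms[unfolded frechet_derivative_works]]]
  by (simp add: wirtinger_def field_simps)

lemma wirtinger_sum:
  assumes "finite I" "\<And>i. i \<in> I \<Longrightarrow> F i differentiable at z"
  shows "wirtinger a k (\<lambda>x. \<Sum>i\<in>I. F i x) z = (\<Sum>i\<in>I. wirtinger a k (F i) z)"
  using assms
  by (induction I rule: finite_induct) (simp_all add: wirtinger_const wirtinger_add)

lemma wirtinger_mult:
  assumes "F differentiable at z" "G differentiable at z"
  shows "wirtinger a k (\<lambda>x. F x * G x) z = F z * wirtinger a k G z + wirtinger a k F z * G z"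
  unfolding wirtinger_has_derivative[OF has_derivative_mult[OF assms[unfolded frechet_derivative_works]]]
  by (simp add: wirtinger_def field_simps)

lemma wirtinger_bounded_linear:
  assumes "F differentiable at z" "bounded_linear L"
  shows "wirtinger a k (\<lambda>x. L (F x)) z =
    (L (frechet_derivative F (at z) (axis k 1)) + a * L (frechet_derivative F (at z) (axis k \<i>))) / 2"
  by (rule wirtinger_has_derivative, rule bounded_linear.has_derivative[OF assms(2)])
     (use assms(1) frechet_derivative_works in blast)

lemma wirtinger_cnj:
  assumes "F differentiable at z"
  shows "wirtinger a k (\<lambda>x. cnj (F x)) z = cnj (wirtinger (cnj a) k F z)"
  using wirtinger_bounded_linear[OF assms bounded_linear_cnj, of a k] by (simp add: wirtinger_def)

lemma wirtinger_has_derivative_wirtinger: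
  assumes "\<And>v. (\<lambda>x. frechet_derivative F (at x) v) differentiable at z"
  shows "(wirtinger b j F has_derivative
     (\<lambda>u. (frechet_derivative (\<lambda>x. frechet_derivative F (at x) (axis j 1)) (at z) u
        + b * frechet_derivative (\<lambda>x. frechet_derivative F (at x) (axis j \<i>)) (at z) u) / 2)) (at z)"
  unfolding wirtinger_def[abs_def] divide_inverse
  by (intro has_derivative_mult_left has_derivative_add has_derivative_mult_right)
     (use assms frechet_derivative_works in blast)+

lemma Ck_on_2D:
  assumes "Ck_on 2 S F" "z \<in> S"
  shows "F differentiable at z" "(\<lambda>x. frechet_derivative F (at x) v) differentiable at z"
  using assms by (auto simp: eval_nat_numeral)

lemma differentiable_wirtinger:
  assumes "Ck_on 2 S F" "z \<in> S"
  shows "wirtinger b j F differentiable at z"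
  using wirtinger_has_derivative_wirtinger[OF Ck_on_2D(2)[OF assms]] differentiable_def by blast

text \<open>Both sides expand into second derivatives along real coordinate vectors, and these
  commute. All four combinations of \<partial> and its conjugate are covered at once.\<close>

lemma wirtinger_commute:
  assumes "open S" "Ck_on 2 S F" "z \<in> S"
  shows "wirtinger a k (wirtinger b j F) z = wirtinger b j (wirtinger a k F) z"
proof -
  note W = wirtinger_has_derivative[OF wirtinger_has_derivative_wirtinger[OF Ck_on_2D(2)[OF assms(2,3)]]]
  show ?thesis
    unfolding W
    using frechet_derivative_commute[OF assms(1,3,2), of "axis j 1" "axis k 1"]
      frechet_derivative_commute[OF assms(1,3,2), of "axis j \<i>" "axis k 1"]
      frechet_derivative_commute[OF assms(1,3,2), of "axis j 1" "axis k \<i>"]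
      frechet_derivative_commute[OF assms(1,3,2), of "axis j \<i>" "axis k \<i>"]
    by (simp add: field_simps)
qed

section \<open>Differentiability of determinants; inverse matrices by Cramer's rule\<close>

lemma differentiable_prod:
  fixes F :: "'i \<Rightarrow> 'a::real_normed_vector \<Rightarrow> complex"
  assumes "finite I" "\<And>i. i \<in> I \<Longrightarrow> F i differentiable at z"
  shows "(\<lambda>x. \<Prod>i\<in>I. F i x) differentiable at z"
  using assms by (induction I rule: finite_induct) auto

lemma differentiable_det:
  fixes A :: "'a::real_normed_vector \<Rightarrow> complex^'n::finite^'n"
  assumes "\<And>i j. (\<lambda>x. A x $ i $ j) differentiable at z"
  shows "(\<lambda>x. det (A x)) differentiable at z"
  unfolding det_def using assms
  by (intro differentiable_sum differentiable_mult differentiable_const differentiable_prod ballI)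
     (auto simp: finite_permutations)

text \<open>The m-th column of the inverse solves \<open>A *v x = axis m 1\<close>. Writing its
  entries as quotients of determinants is what makes the inverse metric differentiable.\<close>

lemma matrix_inv_cramer:
  fixes A :: "complex^'n::finite^'n"
  assumes "invertible A"
  shows "matrix_inv A $ k $ m = det (\<chi> i j. if j = k then (axis m 1 :: complex^'n) $ i else A $ i $ j) / det A"
proof -
  have inv: "A ** matrix_inv A = mat 1"
    using assms unfolding invertible_def matrix_inv_def by (rule someI2_ex) blast
  have "(A ** matrix_inv A) $ i $ m = (axis m 1 :: complex^'n) $ i" for i
    by (simp add: inv mat_def axis_def)
  then have "A *v (\<chi> i. matrix_inv A $ i $ m) = axis m 1"
    by (simp add: vec_eq_iff matrix_vector_mult_def matrix_matrix_mult_def)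
  moreover have "det A \<noteq> 0" using assms by (simp add: invertible_det_nz)
  ultimately have "(\<chi> i. matrix_inv A $ i $ m) =
      (\<chi> k. det (\<chi> i j. if j = k then (axis m 1 :: complex^'n) $ i else A $ i $ j) / det A)"
    using cramer by blast
  then show ?thesis by (metis (no_types, lifting) vec_lambda_beta)
qed

lemma axis_imaginary: "axis k \<i> = \<i> *s (axis k 1 :: complex^'n::finite)"
  by (simp add: vec_eq_iff axis_def)

lemma i_i_mult_vec [simp]: "\<i> *s (\<i> *s v) = - (v :: complex^'n::finite)"
  by (simp add: vec_eq_iff)

lemma scalar_mult_complex_vec: "c *s v = Re c *\<^sub>R v + Im c *\<^sub>R (\<i> *s v)" for v :: "complex^'n::finite"
  by (simp add: vec_eq_iff complex_eq_iff)

lemma i_mult_add: "\<i> *s (u + v) = \<i> *s u + \<i> *s (v :: complex^'n::finite)"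
  by (simp add: vec_eq_iff algebra_simps)

lemma i_mult_scaleR: "\<i> *s (r *\<^sub>R v) = r *\<^sub>R (\<i> *s (v :: complex^'n::finite))"
  by (simp add: vec_eq_iff)

section \<open>Hermitian metrics on a coordinate domain and their Chern curvature\<close>

text \<open>Formulated for one open set of coordinates, so that the metric of \<open>M\<close> and
  its conformal multiple can both be instances.\<close>

locale hermitian_on =
  fixes W :: "(complex^'n::finite) set" and g :: "'n form2"
  assumes open_W: "open W"
    and bilin: "x \<in> W \<Longrightarrow> bilinear (g x)"
    and g_sym: "x \<in> W \<Longrightarrow> g x u v = g x v u"
    and pos: "x \<in> W \<Longrightarrow> v \<noteq> 0 \<Longrightarrow> g x v v > 0"
    and J_inv: "x \<in> W \<Longrightarrow> g x (\<i> *s u) (\<i> *s v) = g x u v"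
    and smooth: "Ck_on k W (\<lambda>x. g x u v)"
begin

lemma J_left: "x \<in> W \<Longrightarrow> g x (\<i> *s u) v = - g x u (\<i> *s v)"
  using J_inv[of x "\<i> *s u" v] by (simp add: bilinear_lneg[OF bilin])

lemma gij_eq:
  assumes "x \<in> W"
  shows "gij g x $ i $ j =
    (of_real (g x (axis i 1) (axis j 1)) + \<i> * of_real (g x (axis i 1) (\<i> *s axis j 1))) / 2"
  by (simp add: gij_def axis_imaginary J_inv[OF assms] J_left[OF assms] bilinear_rneg[OF bilin[OF assms]])

text \<open>The right side is complex linear in \<open>u\<close> and antilinear in \<open>v\<close>,
  hence fixed by its values on the standard basis. It translates orthonormality of a frame into real
  statements about \<open>g\<close>; because of the factor 1/2, frame vectors have squared length 2
  for \<open>g\<close>.\<close>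

lemma gij_sesquilinear:
  assumes "x \<in> W"
  shows "(\<Sum>i\<in>UNIV. \<Sum>j\<in>UNIV. gij g x $ i $ j * u $ i * cnj (v $ j)) =
    (of_real (g x u v) + \<i> * of_real (g x u (\<i> *s v))) / 2"
proof -
  note B = bilin[OF assms]
  define H where "H u v = (of_real (g x u v) + \<i> * of_real (g x u (\<i> *s v))) / 2" for u v
  have lin1: "linear (\<lambda>u. H u v)" for v
    by (intro linearI)
       (simp_all add: H_def bilinear_ladd[OF B] bilinear_lmul[OF B] complex_eq_iff field_simps)
  have lin2: "linear (H u)" for u
    by (intro linearI)
       (simp_all add: H_def i_mult_add i_mult_scaleR bilinear_radd[OF B] bilinear_rmul[OF B] complex_eq_iff field_simps)
  have J1: "H (\<i> *s u) v = \<i> * H u v" for u v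
    by (simp add: H_def J_left[OF assms] J_inv[OF assms] bilinear_rneg[OF B] field_simps)
  have J2: "H u (\<i> *s v) = - \<i> * H u v" for u v
    by (simp add: H_def bilinear_rneg[OF B] field_simps)
  have s1: "H (c *s u) v = c * H u v" for c u v
    by (subst scalar_mult_complex_vec)
       (simp add: linear_add[OF lin1] linear_cmul[OF lin1] J1 complex_eq_iff)
  have s2: "H u (c *s v) = cnj c * H u v" for c u v
    by (subst scalar_mult_complex_vec)
       (simp add: linear_add[OF lin2] linear_cmul[OF lin2] J2 complex_eq_iff)
  have "H u v = H (\<Sum>i\<in>UNIV. u $ i *s axis i 1) (\<Sum>j\<in>UNIV. v $ j *s axis j 1)"
    by (simp add: basis_expansion)
  also have "\<dots> = (\<Sum>i\<in>UNIV. \<Sum>j\<in>UNIV. H (axis i 1) (axis j 1) * u $ i * cnj (v $ j))"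
    by (simp add: linear_sum[OF lin1] linear_sum[OF lin2] s1 s2 sum_distrib_left mult_ac, rule sum.swap)
  finally show ?thesis by (simp add: H_def gij_eq[OF assms])
qed

lemma gij_cnj:
  assumes "x \<in> W"
  shows "cnj (gij g x $ i $ j) = gij g x $ j $ i"
proof -
  have "g x (axis j a) (axis i b) = g x (axis i b) (axis j a)" for a b
    by (rule g_sym[OF assms])
  then show ?thesis unfolding gij_def by (simp add: complex_eq_iff)
qed

lemma Ck_on_gij: "Ck_on k W (\<lambda>x. gij g x $ i $ j)"
proof -
  have real: "Ck_on k W (\<lambda>x. c * of_real (g x u v))" for c :: complex and u v
    by (intro Ck_on_bounded_linear[OF open_W _ bounded_linear_mult_right]
        Ck_on_bounded_linear[OF open_W _ bounded_linear_of_real] smooth)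
  have "Ck_on k W (\<lambda>x. (1 / 2) * of_real (g x (axis i 1) (axis j 1))
      + (\<i> / 2) * of_real (g x (axis i 1) (\<i> *s axis j 1)))"
    by (intro Ck_on_add[OF open_W] real)
  then show ?thesis
    by (rule Ck_on_cong[OF open_W]) (simp add: gij_eq field_simps)
qed

lemma gij_differentiable: "x \<in> W \<Longrightarrow> (\<lambda>x. gij g x $ i $ j) differentiable at x"
  using Ck_on_2D(1)[OF Ck_on_gij] by blast

text \<open>A kernel vector \<open>y\<close> would give \<open>g x y y = 0\<close> through the
  sesquilinear form, against positivity.\<close>

lemma gij_invertible:
  assumes "x \<in> W"
  shows "invertible (transpose (gij g x))"
proof -
  have "y = 0" if "transpose (gij g x) *v y = 0" for y
  proof (rule ccontr)
    assume "y \<noteq> 0"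
    have "(\<Sum>i\<in>UNIV. gij g x $ i $ j * y $ i) = 0" for j
      using that by (simp add: vec_eq_iff matrix_vector_mult_def transpose_def)
    then have "(\<Sum>j\<in>UNIV. (\<Sum>i\<in>UNIV. gij g x $ i $ j * y $ i) * cnj (y $ j)) = 0" by simp
    then have "(\<Sum>i\<in>UNIV. \<Sum>j\<in>UNIV. gij g x $ i $ j * y $ i * cnj (y $ j)) = 0"
      by (subst sum.swap) (simp add: sum_distrib_right)
    then have "g x y y = 0"
      by (simp add: gij_sesquilinear[OF assms] complex_eq_iff)
    then show False using pos[OF assms \<open>y \<noteq> 0\<close>] by simp
  qed
  then show ?thesis unfolding invertible_left_inverse matrix_left_invertible_ker by blast
qed

lemma g_inv_left:
  assumes "x \<in> W"
  shows "(\<Sum>m\<in>UNIV. g_inv g x $ j $ m * gij g x $ i $ m) = (if i = j then 1 else 0)"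
proof -
  have "g_inv g x ** transpose (gij g x) = mat 1"
    using gij_invertible[OF assms] unfolding g_inv_def invertible_def matrix_inv_def
    by (rule someI2_ex) blast
  then have "(g_inv g x ** transpose (gij g x)) $ j $ i = mat 1 $ j $ i" by simp
  then show ?thesis by (simp add: matrix_matrix_mult_def transpose_def mat_def eq_commute)
qed

lemma g_inv_right:
  assumes "x \<in> W"
  shows "(\<Sum>p\<in>UNIV. g_inv g x $ p $ q * gij g x $ p $ j) = (if j = q then 1 else 0)"
proof -
  have "transpose (gij g x) ** g_inv g x = mat 1"
    using gij_invertible[OF assms] unfolding g_inv_def invertible_def matrix_inv_def
    by (rule someI2_ex) blast
  then have "(transpose (gij g x) ** g_inv g x) $ j $ q = mat 1 $ j $ q" by simp
  then show ?thesis by (simp add: matrix_matrix_mult_def transpose_def mat_def mult.commute)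
qed

lemma g_inv_differentiable:
  assumes "x \<in> W"
  shows "(\<lambda>x. g_inv g x $ j $ m) differentiable at x"
proof -
  \<comment> \<open>\<open>det (N y)\<close> is the numerator of Cramer's rule for the entry
    \<open>j\<close>, \<open>m\<close>.\<close>
  define N where "N y = (\<chi> i k. if k = j then (axis m 1 :: complex^'n) $ i else transpose (gij g y) $ i $ k)" for y
  have gd: "(\<lambda>y. transpose (gij g y) $ i $ k) differentiable at x" for i k
    using gij_differentiable[OF assms] by (simp add: transpose_def)
  then have "(\<lambda>y. N y $ i $ k) differentiable at x" for i k
    by (cases "k = j") (simp_all add: N_def)
  then have "(\<lambda>y. det (N y)) differentiable at x" by (rule differentiable_det)
  moreover have "(\<lambda>y. det (transpose (gij g y))) differentiable at x"
    using gd by (rule differentiable_det)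
  moreover have "det (transpose (gij g x)) \<noteq> 0"
    using gij_invertible[OF assms] by (simp only: invertible_det_nz not_False_eq_True)
  ultimately have "(\<lambda>y. det (N y) / det (transpose (gij g y))) differentiable at x"
    by (rule differentiable_divide)
  then obtain D where D: "((\<lambda>y. det (N y) / det (transpose (gij g y))) has_derivative D) (at x)"
    unfolding differentiable_def by blast
  have "((\<lambda>x. g_inv g x $ j $ m) has_derivative D) (at x)"
    by (rule has_derivative_transform_within_open[OF D open_W assms])
       (simp only: g_inv_def N_def matrix_inv_cramer[OF gij_invertible])
  then show ?thesis unfolding differentiable_def by blast
qed

lemma d_hol_gij_differentiable: "x \<in> W \<Longrightarrow> d_hol k (\<lambda>x. gij g x $ i $ j) differentiable at x"
  unfolding d_hol_wirtinger by (rule differentiable_wirtinger[OF Ck_on_gij])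

lemma chern_Gamma_differentiable: "x \<in> W \<Longrightarrow> chern_Gamma g k i j differentiable at x"
  unfolding chern_Gamma_def[abs_def]
  by (intro differentiable_sum differentiable_mult g_inv_differentiable d_hol_gij_differentiable ballI) auto

text \<open>Contraction with \<open>gij\<close> undoes the \<open>g_inv\<close> inside
  \<open>chern_Gamma\<close>.\<close>

lemma chern_Gamma_lower:
  assumes "x \<in> W"
  shows "(\<Sum>m\<in>UNIV. gij g x $ m $ l * chern_Gamma g k i m x) = d_hol k (\<lambda>x. gij g x $ i $ l) x"
proof -
  have "(\<Sum>m\<in>UNIV. gij g x $ m $ l * chern_Gamma g k i m x) =
     (\<Sum>q\<in>UNIV. (\<Sum>m\<in>UNIV. g_inv g x $ m $ q * gij g x $ m $ l) * d_hol k (\<lambda>x. gij g x $ i $ q) x)"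
    unfolding chern_Gamma_def sum_distrib_left sum_distrib_right
    by (subst sum.swap) (simp add: mult_ac)
  also have "\<dots> = d_hol k (\<lambda>x. gij g x $ i $ l) x"
    by (simp add: g_inv_right[OF assms] if_distrib[of "\<lambda>c. c * _"] cong: if_cong)
  finally show ?thesis .
qed

lemma d_antihol_gij:
  assumes "x \<in> W"
  shows "d_antihol k (\<lambda>x. gij g x $ i $ j) x = cnj (d_hol k (\<lambda>x. gij g x $ j $ i) x)"
proof -
  have "d_antihol k (\<lambda>x. gij g x $ i $ j) x = d_antihol k (\<lambda>x. cnj (gij g x $ j $ i)) x"
    unfolding d_antihol_wirtinger
    by (rule wirtinger_cong[OF open_W assms]) (simp add: gij_cnj)
  then show ?thesis
    by (simp add: d_antihol_wirtinger d_hol_wirtinger wirtinger_cnj gij_differentiable[OF assms])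
qed

text \<open>The inverse metric enters only undifferentiated: the product rule is applied to
  \<open>chern_Gamma_lower\<close>.\<close>

lemma chern_curvature_eq:
  assumes "z \<in> W"
  shows "chern_curvature g z i j k l =
    - d_antihol j (d_hol i (\<lambda>x. gij g x $ k $ l)) z
    + (\<Sum>m\<in>UNIV. d_antihol j (\<lambda>x. gij g x $ m $ l) z * chern_Gamma g i k m z)"
proof -
  have "d_antihol j (d_hol i (\<lambda>x. gij g x $ k $ l)) z =
     d_antihol j (\<lambda>x. \<Sum>m\<in>UNIV. gij g x $ m $ l * chern_Gamma g i k m x) z"
    unfolding d_antihol_wirtinger
    by (rule wirtinger_cong[OF open_W assms]) (simp add: chern_Gamma_lower)
  also have "\<dots> = (\<Sum>m\<in>UNIV. gij g z $ m $ l * d_antihol j (chern_Gamma g i k m) z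
      + d_antihol j (\<lambda>x. gij g x $ m $ l) z * chern_Gamma g i k m z)"
    unfolding d_antihol_wirtinger using assms
    by (simp add: wirtinger_sum wirtinger_mult gij_differentiable chern_Gamma_differentiable)
  finally show ?thesis
    by (simp add: chern_curvature_def chern_curvature_up_def sum.distrib sum_negf)
qed

end

section \<open>Curvature symmetries of a Kaehler metric\<close>

text \<open>The added assumption is the vanishing of the (2,1)-part of the differential of the
  fundamental form; the (1,2)-part is its conjugate.\<close>

locale kaehler_on = hermitian_on +
  assumes kaehler: "x \<in> W \<Longrightarrow>
    d_hol k (\<lambda>x. gij g x $ i $ j) x = d_hol i (\<lambda>x. gij g x $ k $ j) x"
begin

lemma chern_Gamma_commute: "x \<in> W \<Longrightarrow> chern_Gamma g k i j x = chern_Gamma g i k j x"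
  unfolding chern_Gamma_def using kaehler[of x k i] by simp

text \<open>The Kaehler condition makes the Christoffel symbols symmetric in their lower indices,
  and the curvature is their derivative.\<close>

lemma chern_curvature_swap_hol:
  assumes "z \<in> W"
  shows "chern_curvature g z i j k l = chern_curvature g z k j i l"
proof -
  have "d_antihol j (chern_Gamma g i k m) z = d_antihol j (chern_Gamma g k i m) z" for m
    unfolding d_antihol_wirtinger
    by (rule wirtinger_cong[OF open_W assms]) (rule chern_Gamma_commute)
  then show ?thesis by (simp add: chern_curvature_def chern_curvature_up_def)
qed

text \<open>Uses the conjugate Kaehler condition in \<open>chern_curvature_eq\<close>. In the
  second-order term the two derivatives are exchanged first, so that the condition applies to the
  inner one, and exchanged back afterwards.\<close>

lemma chern_curvature_swap_antihol:
  assumes "z \<in> W"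
  shows "chern_curvature g z i j k l = chern_curvature g z i l k j"
proof -
  have *: "d_antihol j (\<lambda>x. gij g x $ m $ l) x = d_antihol l (\<lambda>x. gij g x $ m $ j) x" if "x \<in> W" for x m
    using kaehler[OF that, of j l m] by (simp add: d_antihol_gij[OF that])
  have "d_antihol j (d_hol i (\<lambda>x. gij g x $ k $ l)) z = d_hol i (d_antihol j (\<lambda>x. gij g x $ k $ l)) z"
    unfolding d_antihol_wirtinger d_hol_wirtinger
    by (rule wirtinger_commute[OF open_W Ck_on_gij assms])
  also have "\<dots> = d_hol i (d_antihol l (\<lambda>x. gij g x $ k $ j)) z"
    unfolding d_hol_wirtinger by (rule wirtinger_cong[OF open_W assms]) (rule *)
  also have "\<dots> = d_antihol l (d_hol i (\<lambda>x. gij g x $ k $ j)) z"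
    unfolding d_antihol_wirtinger d_hol_wirtinger
    by (rule wirtinger_commute[OF open_W Ck_on_gij assms, symmetric])
  finally show ?thesis
    by (simp add: chern_curvature_eq[OF assms] *[OF assms])
qed

end

section \<open>Linear algebra and tensors in a frame\<close>

text \<open>\<open>T\<close> expresses \<open>G\<close> through the Euclidean inner product,
  \<open>G a w = T a \<bullet> w\<close>. Positivity makes \<open>T\<close> injective, hence onto.
  This will supply the gradient of the potential.\<close>

lemma bilinear_riesz:
  fixes G :: "'v::euclidean_space \<Rightarrow> 'v \<Rightarrow> real"
  assumes G: "bilinear G" and pos: "\<And>v. v \<noteq> 0 \<Longrightarrow> G v v > 0" and L: "linear L"
  shows "\<exists>X. \<forall>w. G X w = L w"
proof -
  have lin: "linear (G a)" "linear (\<lambda>a. G a w)" for a w using G by (simp_all add: bilinear_def)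
  define T where "T a = (\<Sum>b\<in>Basis. G a b *\<^sub>R b)" for a
  have repr: "F w = (\<Sum>b\<in>Basis. F b *\<^sub>R b) \<bullet> w" if "linear F" for F :: "'v \<Rightarrow> real" and w
  proof -
    have "F w = F (\<Sum>b\<in>Basis. (w \<bullet> b) *\<^sub>R b)" by (simp add: euclidean_representation)
    also have "\<dots> = (\<Sum>b\<in>Basis. (w \<bullet> b) * F b)" by (simp add: linear_sum[OF that] linear_cmul[OF that])
    finally show ?thesis by (simp add: inner_sum_left inner_commute[of w] mult.commute)
  qed
  have "linear T"
    unfolding T_def
    by (intro linearI) (simp_all add: linear_add[OF lin(2)] linear_cmul[OF lin(2)]
        scaleR_add_left sum.distrib scaleR_right.sum)
  moreover have "a = 0" if "T a = 0" for a
  proof (rule ccontr)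
    assume "a \<noteq> 0"
    moreover have "G a a = 0" using repr[OF lin(1), of a a] that by (simp add: T_def)
    ultimately show False using pos[of a] by simp
  qed
  ultimately have "surj T"
    by (simp add: linear_injective_imp_surjective linear_injective_0)
  then obtain X where "T X = (\<Sum>b\<in>Basis. L b *\<^sub>R b)" by (metis surjD)
  then have "G X w = L w" for w using repr[OF lin(1), of X w] repr[OF L, of w] by (simp add: T_def)
  then show ?thesis by blast
qed

lemma matrix_inv_eqI:
  fixes A B :: "complex^'n::finite^'n"
  assumes "A ** B = mat 1"
  shows "matrix_inv A = B"
proof -
  have BA: "B ** A = mat 1" using assms by (simp add: matrix_left_right_inverse)
  have "A ** matrix_inv A = mat 1"
    unfolding matrix_inv_def by (rule someI2[of _ B]) (use assms BA in auto)
  then have "B ** (A ** matrix_inv A) = B" by simp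
  then show ?thesis by (simp add: matrix_mul_assoc BA)
qed

section \<open>Four-index tensors in a frame\<close>

text \<open>One factor \<open>r\<close> for each slot; being real, it survives conjugation. This
  relates frames of conformal metrics.\<close>

lemma in_frame_scale:
  "in_frame X (\<lambda>a. of_real r *s e a) a b c d = of_real (r ^ 4) * in_frame X e a b c d"
  unfolding in_frame_def sum_distrib_left by (simp add: power4_eq_xxxx mult_ac)

lemma sum_swap_pairs:
  "(\<Sum>i\<in>I. \<Sum>j\<in>J. \<Sum>p\<in>P. \<Sum>q\<in>Q. f i j p q) = (\<Sum>p\<in>P. \<Sum>q\<in>Q. \<Sum>i\<in>I. \<Sum>j\<in>J. f i j p q)"
proof -
  have "(\<Sum>i\<in>I. \<Sum>j\<in>J. \<Sum>p\<in>P. \<Sum>q\<in>Q. f i j p q) = (\<Sum>i\<in>I. \<Sum>p\<in>P. \<Sum>j\<in>J. \<Sum>q\<in>Q. f i j p q)"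
    by (intro sum.cong refl sum.swap)
  also have "\<dots> = (\<Sum>p\<in>P. \<Sum>i\<in>I. \<Sum>j\<in>J. \<Sum>q\<in>Q. f i j p q)"
    by (rule sum.swap)
  also have "\<dots> = (\<Sum>p\<in>P. \<Sum>i\<in>I. \<Sum>q\<in>Q. \<Sum>j\<in>J. f i j p q)"
    by (intro sum.cong refl sum.swap)
  also have "\<dots> = (\<Sum>p\<in>P. \<Sum>q\<in>Q. \<Sum>i\<in>I. \<Sum>j\<in>J. f i j p q)"
    by (intro sum.cong refl sum.swap)
  finally show ?thesis .
qed

lemma sum_reverse3:
  "(\<Sum>j\<in>J. \<Sum>k\<in>K. \<Sum>l\<in>L. f j k l) = (\<Sum>l\<in>L. \<Sum>k\<in>K. \<Sum>j\<in>J. f j k l)"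
proof -
  have "(\<Sum>j\<in>J. \<Sum>k\<in>K. \<Sum>l\<in>L. f j k l) = (\<Sum>j\<in>J. \<Sum>l\<in>L. \<Sum>k\<in>K. f j k l)"
    by (intro sum.cong refl sum.swap)
  also have "\<dots> = (\<Sum>l\<in>L. \<Sum>j\<in>J. \<Sum>k\<in>K. f j k l)"
    by (rule sum.swap)
  also have "\<dots> = (\<Sum>l\<in>L. \<Sum>k\<in>K. \<Sum>j\<in>J. f j k l)"
    by (intro sum.cong refl sum.swap)
  finally show ?thesis .
qed

text \<open>Both exchanges together give \<open>X i j k l = X k l i j\<close>; the rest is a
  renaming of summation indices.\<close>

lemma in_frame_swap_pairs:
  assumes "\<And>i j k l. X i j k l = X k j i l" "\<And>i j k l. X i j k l = X i l k j"
  shows "in_frame X e m m k k = in_frame X e k k m m"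
proof -
  have "in_frame X e m m k k = (\<Sum>i\<in>UNIV. \<Sum>j\<in>UNIV. \<Sum>p\<in>UNIV. \<Sum>q\<in>UNIV.
        X p q i j * e m $ i * cnj (e m $ j) * e k $ p * cnj (e k $ q))"
    unfolding in_frame_def by (intro sum.cong refl) (metis assms)
  also have "\<dots> = (\<Sum>p\<in>UNIV. \<Sum>q\<in>UNIV. \<Sum>i\<in>UNIV. \<Sum>j\<in>UNIV.
        X p q i j * e m $ i * cnj (e m $ j) * e k $ p * cnj (e k $ q))"
    by (rule sum_swap_pairs)
  finally show ?thesis unfolding in_frame_def by (simp add: mult_ac)
qed

lemma in_frame_add:
  "in_frame (\<lambda>i j k l. X i j k l + Y i j k l) e a b c d = in_frame X e a b c d + in_frame Y e a b c d"
  by (simp add: in_frame_def sum.distrib algebra_simps)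

lemma in_frame_cmul:
  "in_frame (\<lambda>i j k l. r * X i j k l) e a b c d = r * in_frame X e a b c d"
  by (simp add: in_frame_def sum_distrib_left mult_ac)

lemma in_frame_split:
  "in_frame (\<lambda>i j k l. P i j * R k l) e a b c d =
     (\<Sum>i\<in>UNIV. \<Sum>j\<in>UNIV. P i j * e a $ i * cnj (e b $ j)) *
     (\<Sum>k\<in>UNIV. \<Sum>l\<in>UNIV. R k l * e c $ k * cnj (e d $ l))"
  unfolding in_frame_def
  by (simp only: sum_distrib_right, simp only: sum_distrib_left, simp only: mult_ac)

text \<open>Exchanging the two barred slots turns the crossed product into a direct one.\<close>

lemma in_frame_split_swap:
  "in_frame (\<lambda>i j k l. P i l * R k j) e a b c d =
     (\<Sum>i\<in>UNIV. \<Sum>l\<in>UNIV. P i l * e a $ i * cnj (e d $ l)) *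
     (\<Sum>k\<in>UNIV. \<Sum>j\<in>UNIV. R k j * e c $ k * cnj (e b $ j))"
proof -
  have "in_frame (\<lambda>i j k l. P i l * R k j) e a b c d = in_frame (\<lambda>i j k l. P i j * R k l) e a d c b"
    unfolding in_frame_def
    by (rule sum.cong[OF refl], subst sum_reverse3, simp only: mult_ac)
  then show ?thesis by (simp only: in_frame_split)
qed

section \<open>Bessel's inequality and symmetrization of quadratic forms\<close>

text \<open>The hypotheses make \<open>u\<close>, \<open>\<i> *s u\<close>, \<open>v\<close>,
  \<open>\<i> *s v\<close> pairwise orthogonal of squared length 2, the normalization that frame
  vectors have in \<open>gij_sesquilinear\<close>.\<close>

lemma bessel_two_complex_vectors:
  fixes G :: "complex^'n::finite \<Rightarrow> complex^'n \<Rightarrow> real"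
  assumes G: "bilinear G" and sym: "\<And>u v. G u v = G v u" and pos: "\<And>v. v \<noteq> 0 \<Longrightarrow> G v v > 0"
    and J: "\<And>u v. G (\<i> *s u) (\<i> *s v) = G u v"
    and uu: "G u u = 2" "G u (\<i> *s u) = 0" and vv: "G v v = 2" "G v (\<i> *s v) = 0"
    and uv: "G u v = 0" "G u (\<i> *s v) = 0"
  shows "(G X u)\<^sup>2 + (G X (\<i> *s u))\<^sup>2 + (G X v)\<^sup>2 + (G X (\<i> *s v))\<^sup>2 \<le> 2 * G X X"
proof -
  \<comment> \<open>Twice the orthogonal projection of \<open>X\<close> onto the span of the four
    vectors, as each has squared length 2; hence \<open>(1/2) *\<^sub>R P\<close> is subtracted
    below.\<close>
  define P where "P = G X u *\<^sub>R u + G X (\<i> *s u) *\<^sub>R (\<i> *s u) + G X v *\<^sub>R v + G X (\<i> *s v) *\<^sub>R (\<i> *s v)"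
  let ?t = "(G X u)\<^sup>2 + (G X (\<i> *s u))\<^sup>2 + (G X v)\<^sup>2 + (G X (\<i> *s v))\<^sup>2"
  note b = bilinear_ladd[OF G] bilinear_radd[OF G] bilinear_lmul[OF G] bilinear_rmul[OF G]
    bilinear_lsub[OF G] bilinear_rsub[OF G]
  have z1: "G (\<i> *s u) v = 0"
    using J[of "\<i> *s u" v] uv(2) by (simp add: bilinear_lneg[OF G])
  have z: "G (\<i> *s u) u = 0" "G (\<i> *s v) v = 0" "G v u = 0" "G (\<i> *s v) u = 0"
    "G v (\<i> *s u) = 0" "G (\<i> *s v) (\<i> *s u) = 0"
    using uu vv uv z1 sym J by metis+
  have XP: "G X P = ?t"
    by (simp add: P_def b power2_eq_square)
  have PX: "G P X = ?t" using sym XP by simp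
  have PP: "G P P = 2 * ?t"
    by (simp add: P_def b uu vv uv z z1 J power2_eq_square algebra_simps)
  have "0 \<le> G (X - (1/2) *\<^sub>R P) (X - (1/2) *\<^sub>R P)"
    using pos[of "X - (1/2) *\<^sub>R P"] bilinear_lzero[OF G] by (cases "X - (1/2) *\<^sub>R P = 0") auto
  also have "\<dots> = G X X - ?t / 2"
    by (simp add: b XP PX PP)
  finally show ?thesis by simp
qed

lemma frame_product:
  "(\<Sum>i\<in>UNIV. \<Sum>j\<in>UNIV. H i * cnj (K j) * u $ i * cnj (v $ j)) =
    (\<Sum>i\<in>UNIV. H i * u $ i) * cnj (\<Sum>j\<in>UNIV. K j * v $ j)"
  by (simp add: sum_product mult_ac)

text \<open>Averaging with the sum in which \<open>k\<close> and \<open>m\<close> are exchanged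
  completes the square.\<close>

lemma sum_sq_diff_symmetric:
  fixes c :: "'k::finite \<Rightarrow> 'k \<Rightarrow> real"
  assumes "\<And>k m. c m k = c k m"
  shows "(\<Sum>k\<in>UNIV. \<Sum>m\<in>UNIV. c m k * ((l k)\<^sup>2 - l k * l m)) =
    (\<Sum>k\<in>UNIV. \<Sum>m\<in>UNIV. c m k * (l k - l m)\<^sup>2) / 2"
proof -
  have "(\<Sum>k\<in>UNIV. \<Sum>m\<in>UNIV. c m k * ((l k)\<^sup>2 - l k * l m)) =
    (\<Sum>k\<in>UNIV. \<Sum>m\<in>UNIV. c m k * ((l m)\<^sup>2 - l k * l m))"
    by (subst sum.swap) (simp add: assms mult.commute[of "l _" "l _"])
  moreover have "(\<Sum>k\<in>UNIV. \<Sum>m\<in>UNIV. c m k * (l k - l m)\<^sup>2) =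
    (\<Sum>k\<in>UNIV. \<Sum>m\<in>UNIV. c m k * ((l k)\<^sup>2 - l k * l m)) +
    (\<Sum>k\<in>UNIV. \<Sum>m\<in>UNIV. c m k * ((l m)\<^sup>2 - l k * l m))"
    unfolding sum.distrib[symmetric]
    by (intro sum.cong refl) (simp add: power2_eq_square algebra_simps)
  ultimately show ?thesis by simp
qed

section \<open>Local computation for a parallel Lee form\<close>

text \<open>What a lifted chart provides: \<open>h\<close> is the potential of the cover and
  \<open>gt\<close> its Kaehler metric. \<open>gt\<close> is a separate parameter tied to
  \<open>g\<close> only on \<open>W\<close>, and \<open>levi_civita_unique\<close> gives the
  description of \<open>levi_civita\<close> its meaning.\<close>

locale local_vaisman = hermitian_on W g
  for W :: "(complex^'n::finite) set" and g :: "'n form2" +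
  fixes gt :: "'n form2" and th :: "'n form1" and h :: "complex^'n \<Rightarrow> real"
  assumes smooth_h: "Ck_on k W h"
    and lee: "x \<in> W \<Longrightarrow> th x v = - frechet_derivative h (at x) v"
    and d_omega: "x \<in> W \<Longrightarrow> ext_deriv2 (fundamental_form g) x u v w =
      wedge12 th (fundamental_form g) x u v w"
    and parallel: "x \<in> W \<Longrightarrow> nabla_LC g th x u v = 0"
    and levi_civita_unique: "x \<in> W \<Longrightarrow> \<exists>!\<Gamma>. torsion_free_metric_at g x \<Gamma>"
    and conformal: "x \<in> W \<Longrightarrow> gt x u v = exp (h x) * g x u v"
begin

abbreviation dg where "dg x u v w \<equiv> frechet_derivative (\<lambda>x. g x v w) (at x) u"
abbreviation dh where "dh x v \<equiv> frechet_derivative h (at x) v"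
abbreviation hess where "hess x u v \<equiv> frechet_derivative (\<lambda>x. dh x v) (at x) u"

section \<open>First derivatives of the metric and the complex structure\<close>

lemma g_differentiable: "x \<in> W \<Longrightarrow> (\<lambda>x. g x u v) differentiable at x"
  using Ck_on_2D(1)[OF smooth] by blast

text \<open>Algebraic identities of the metric hold throughout the open set \<open>W\<close> and may
  therefore be differentiated; the sign rules for \<open>\<i>\<close> pass to \<open>dg\<close> in
  this way.\<close>

lemma dg_minus:
  assumes "x \<in> W" "\<And>y. y \<in> W \<Longrightarrow> g y v' w' = - g y v w"
  shows "dg x u v' w' = - dg x u v w"
proof -
  have "frechet_derivative (\<lambda>x. g x v' w') (at x) = frechet_derivative (\<lambda>x. - g x v w) (at x)"
    by (rule frechet_derivative_cong_open[OF open_W assms(1)]) (rule assms(2))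
  moreover have "((\<lambda>x. - g x v w) has_derivative (\<lambda>u. - dg x u v w)) (at x)"
    using g_differentiable[OF assms(1)] by (intro has_derivative_minus) (simp flip: frechet_derivative_works)
  then have "frechet_derivative (\<lambda>x. - g x v w) (at x) = (\<lambda>u. - dg x u v w)"
    by (rule frechet_derivative_at[symmetric])
  ultimately show ?thesis by simp
qed

lemma dg_eq:
  assumes "x \<in> W" "\<And>y. y \<in> W \<Longrightarrow> g y v' w' = g y v w"
  shows "dg x u v' w' = dg x u v w"
  using frechet_derivative_cong_open[OF open_W assms(1), of "\<lambda>x. g x v' w'" "\<lambda>x. g x v w"] assms(2)
  by simp

lemma dg_sym: "x \<in> W \<Longrightarrow> dg x u v w = dg x u w v"
  by (rule dg_eq) (auto intro: g_sym)

lemma dg_J: "x \<in> W \<Longrightarrow> dg x u (\<i> *s v) (\<i> *s w) = dg x u v w"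
  by (rule dg_eq) (auto simp: J_inv)

lemma dg_J_left: "x \<in> W \<Longrightarrow> dg x u (\<i> *s v) w = - dg x u v (\<i> *s w)"
  by (rule dg_minus) (auto simp: J_left)

lemma dg_minus_left: "x \<in> W \<Longrightarrow> dg x u (- v) w = - dg x u v w"
  by (rule dg_minus) (auto simp: bilinear_lneg[OF bilin])

lemma dg_minus_right: "x \<in> W \<Longrightarrow> dg x u v (- w) = - dg x u v w"
  by (rule dg_minus) (auto simp: bilinear_rneg[OF bilin])

lemma linear_dh: "x \<in> W \<Longrightarrow> linear (dh x)"
  using Ck_on_2D(1)[OF smooth_h] by (rule linear_frechet_derivative)

section \<open>The LCK identity and the Chern torsion\<close>

lemma lck_identity:
  assumes "x \<in> W"
  shows "dg x u (\<i> *s v) w - dg x v (\<i> *s u) w + dg x w (\<i> *s u) v =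
    - dh x u * g x (\<i> *s v) w + dh x v * g x (\<i> *s u) w - dh x w * g x (\<i> *s u) v"
  using d_omega[OF assms, of u v w]
  by (simp add: ext_deriv2_def fundamental_form_def wedge12_def lee[OF assms])

text \<open>The difference of the LCK identity at \<open>u, v, \<i> *s w\<close> and at
  \<open>\<i> *s u, \<i> *s v, \<i> *s w\<close>; the derivatives in direction
  \<open>\<i> *s w\<close> cancel. It is the (2,1)-part in real terms.\<close>

lemma lck_identity_type_21:
  assumes "x \<in> W"
  shows "dg x u v w - dg x v u w + dg x (\<i> *s u) v (\<i> *s w) - dg x (\<i> *s v) u (\<i> *s w) =
    - dh x u * g x v w + dh x v * g x u w
    - dh x (\<i> *s u) * g x v (\<i> *s w) + dh x (\<i> *s v) * g x u (\<i> *s w)"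
proof -
  have "dg x (\<i> *s w) (\<i> *s u) v = - dg x (\<i> *s w) u (\<i> *s v)" by (rule dg_J_left[OF assms])
  moreover have "g x (\<i> *s u) v = - g x u (\<i> *s v)" by (rule J_left[OF assms])
  ultimately show ?thesis
    using lck_identity[OF assms, where u = u and v = v and w = "\<i> *s w"] lck_identity[OF assms, where u = "\<i> *s u" and v = "\<i> *s v" and w = "\<i> *s w"]
    by (simp add: dg_J[OF assms] J_inv[OF assms] dg_minus_left[OF assms] bilinear_lneg[OF bilin[OF assms]])
qed

abbreviation hc :: "complex^'n \<Rightarrow> complex" where "hc x \<equiv> of_real (h x)"

lemma hc_has_derivative:
  assumes "x \<in> W"
  shows "(hc has_derivative (\<lambda>v. of_real (dh x v))) (at x)"
  using Ck_on_2D(1)[OF smooth_h assms]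
  by (intro bounded_linear.has_derivative[OF bounded_linear_of_real]) (simp flip: frechet_derivative_works)

lemma Ck_on_hc: "Ck_on k W hc"
  by (rule Ck_on_bounded_linear[OF open_W smooth_h bounded_linear_of_real])

lemma d_hol_hc:
  assumes "x \<in> W"
  shows "d_hol k hc x = (of_real (dh x (axis k 1)) - \<i> * of_real (dh x (\<i> *s axis k 1))) / 2"
  unfolding d_hol_wirtinger
  by (simp add: wirtinger_has_derivative[OF hc_has_derivative[OF assms]] axis_imaginary)

lemma d_hol_gij:
  assumes "x \<in> W"
  shows "d_hol k (\<lambda>x. gij g x $ i $ j) x =
   (of_real (dg x (axis k 1) (axis i 1) (axis j 1) + dg x (\<i> *s axis k 1) (axis i 1) (\<i> *s axis j 1))
    + \<i> * of_real (dg x (axis k 1) (axis i 1) (\<i> *s axis j 1) - dg x (\<i> *s axis k 1) (axis i 1) (axis j 1))) / 4"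
proof -
  have of_real: "((\<lambda>x. of_real (g x v w)) has_derivative (\<lambda>u. complex_of_real (dg x u v w))) (at x)" for v w
    using g_differentiable[OF assms, of v w]
    by (intro bounded_linear.has_derivative[OF bounded_linear_of_real]) (simp flip: frechet_derivative_works)
  have "((\<lambda>x. (of_real (g x (axis i 1) (axis j 1)) + \<i> * of_real (g x (axis i 1) (\<i> *s axis j 1))) * inverse 2)
    has_derivative (\<lambda>u. (of_real (dg x u (axis i 1) (axis j 1))
       + \<i> * of_real (dg x u (axis i 1) (\<i> *s axis j 1))) * inverse 2)) (at x)"
    by (intro has_derivative_mult_left has_derivative_add has_derivative_mult_right of_real)
  then have "((\<lambda>x. gij g x $ i $ j) has_derivative (\<lambda>u. (of_real (dg x u (axis i 1) (axis j 1))
       + \<i> * of_real (dg x u (axis i 1) (\<i> *s axis j 1))) * inverse 2)) (at x)"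
    by (rule has_derivative_transform_within_open[OF _ open_W assms]) (simp add: gij_eq)
  from wirtinger_has_derivative[OF this, of "- \<i>" k] show ?thesis
    by (simp add: d_hol_wirtinger axis_imaginary complex_eq_iff)
qed

text \<open>Real and imaginary parts are the two instances of the type (2,1) identity with
  \<open>w\<close> a coordinate vector and \<open>\<i>\<close> times it.\<close>

lemma d_hol_gij_antisym:
  assumes "x \<in> W"
  shows "d_hol k (\<lambda>x. gij g x $ i $ j) x - d_hol i (\<lambda>x. gij g x $ k $ j) x =
    - d_hol k hc x * gij g x $ i $ j + d_hol i hc x * gij g x $ k $ j"
  unfolding d_hol_gij[OF assms] d_hol_hc[OF assms] gij_eq[OF assms]
  using lck_identity_type_21[OF assms, where u = "axis k 1" and v = "axis i 1" and w = "axis j 1"]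
    lck_identity_type_21[OF assms, where u = "axis k 1" and v = "axis i 1" and w = "\<i> *s axis j 1"]
  by (simp add: complex_eq_iff dg_minus_right[OF assms] bilinear_rneg[OF bilin[OF assms]] field_simps)

text \<open>Lowering the index leaves exactly the antisymmetrized derivative of the metric.\<close>

lemma chern_torsion_eq:
  assumes "x \<in> W"
  shows "chern_torsion g i j k x = - d_hol i hc x * gij g x $ j $ k + d_hol j hc x * gij g x $ i $ k"
  unfolding d_hol_gij_antisym[OF assms, symmetric]
  by (simp add: chern_torsion_def chern_torsion_up_def right_diff_distrib sum_subtractf
      chern_Gamma_lower[OF assms])

section \<open>The complex Hessian of the potential from the parallel Lee form\<close>

text \<open>Since \<open>th = - dh\<close> is parallel, the second derivative of \<open>h\<close> is
  cancelled by the Christoffel term alone.\<close>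

lemma hess_christoffel:
  assumes "x \<in> W"
  shows "hess x u v = dh x (levi_civita g x u v)"
proof -
  have "frechet_derivative (\<lambda>y. th y v) (at x) = frechet_derivative (\<lambda>y. - dh y v) (at x)"
    by (rule frechet_derivative_cong_open[OF open_W assms]) (rule lee)
  also have "\<dots> = (\<lambda>u. - hess x u v)"
    using Ck_on_2D(2)[OF smooth_h assms]
    by (intro frechet_derivative_at[symmetric] has_derivative_minus) (simp flip: frechet_derivative_works)
  finally show ?thesis
    using parallel[OF assms, of u v] by (simp add: nabla_LC_def lee[OF assms])
qed

lemma koszul:
  assumes "x \<in> W"
  shows "2 * g x (levi_civita g x u v) w = dg x u v w + dg x v u w - dg x w u v"
proof -
  have "torsion_free_metric_at g x (levi_civita g x)"
    unfolding levi_civita_def by (rule theI'[OF levi_civita_unique[OF assms]])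
  then have s: "levi_civita g x u v = levi_civita g x v u"
    and m: "dg x u v w = g x (levi_civita g x u v) w + g x v (levi_civita g x u w)" for u v w
    unfolding torsion_free_metric_at_def by blast+
  have "g x v (levi_civita g x u w) = g x (levi_civita g x u w) v" for u v w
    by (rule g_sym[OF assms])
  then show ?thesis
    using m[where u = u and v = v and w = w] m[where u = v and v = u and w = w] m[where u = w and v = u and w = v] s[of v u] s[of w u] s[of w v] by simp
qed

text \<open>With \<open>X\<close> the gradient of \<open>h\<close>, the Koszul formula tested
  against \<open>X\<close> expresses the Hessian by derivatives of \<open>g\<close>. In the
  J-invariant sum these are the combinations governed by the LCK identity.\<close>

lemma hess_type_11:
  assumes x: "x \<in> W" and X: "\<And>w. g x X w = dh x w"
  shows "hess x u v + hess x (\<i> *s u) (\<i> *s v) =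
    - dh x u * dh x v - dh x (\<i> *s u) * dh x (\<i> *s v) + dh x X * g x u v"
proof -
  have X': "g x w X = dh x w" for w using X[of w] g_sym[OF x, of w X] by simp
  have H: "2 * hess x u v = dg x u v X + dg x v u X - dg x X u v" for u v
    using koszul[OF x, of u v X] by (simp add: hess_christoffel[OF x] X')
  have s: "dg x X v u = dg x X u v" "g x v u = g x u v" by (rule dg_sym[OF x], rule g_sym[OF x])
  \<comment> \<open>The two Koszul expressions add up to the sum of the two LCK instances, each with
    \<open>X\<close> in the last slot.\<close>
  show ?thesis
    using H[where u = u and v = v] H[where u = "\<i> *s u" and v = "\<i> *s v"]
      lck_identity[OF x, where u = u and v = "\<i> *s v" and w = X] lck_identity[OF x, where u = v and v = "\<i> *s u" and w = X] s
    by (simp add: X' dg_J[OF x] J_inv[OF x] dg_minus_left[OF x] bilinear_lneg[OF bilin[OF x]]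
        linear_neg[OF linear_dh[OF x]] mult.commute)
qed

text \<open>Real and imaginary parts are \<open>hess_type_11\<close> at the pairs formed from
  \<open>axis j 1\<close>, \<open>\<i> *s axis j 1\<close> and \<open>axis i 1\<close>. Here
  \<open>dh x X\<close> is the squared norm of \<open>dh\<close>.\<close>

lemma d_antihol_d_hol_hc:
  assumes x: "x \<in> W" and X: "\<And>w. g x X w = dh x w"
  shows "d_antihol j (d_hol i hc) x =
    - d_hol i hc x * cnj (d_hol j hc x) + of_real (dh x X / 2) * gij g x $ i $ j"
proof -
  have D1: "frechet_derivative hc (at y) v = of_real (dh y v)" if "y \<in> W" for y v
    using frechet_derivative_at[OF hc_has_derivative[OF that]] by metis
  have D2: "frechet_derivative (\<lambda>y. frechet_derivative hc (at y) v) (at x) u = of_real (hess x u v)" for u v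
  proof -
    have "frechet_derivative (\<lambda>y. frechet_derivative hc (at y) v) (at x) =
       frechet_derivative (\<lambda>y. complex_of_real (dh y v)) (at x)"
      by (rule frechet_derivative_cong_open[OF open_W x]) (rule D1)
    also have "\<dots> = (\<lambda>u. of_real (hess x u v))"
      using Ck_on_2D(2)[OF smooth_h x]
      by (intro frechet_derivative_at[symmetric] bounded_linear.has_derivative[OF bounded_linear_of_real])
         (simp flip: frechet_derivative_works)
    finally show ?thesis by simp
  qed
  have lin: "linear (\<lambda>u. hess x u v)" for v
    using Ck_on_2D(2)[OF smooth_h x] by (rule linear_frechet_derivative)
  have W2: "d_antihol j (d_hol i hc) x =
     ((of_real (hess x (axis j 1) (axis i 1)) - \<i> * of_real (hess x (axis j 1) (\<i> *s axis i 1))) / 2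
     + \<i> * ((of_real (hess x (\<i> *s axis j 1) (axis i 1)) - \<i> * of_real (hess x (\<i> *s axis j 1) (\<i> *s axis i 1))) / 2)) / 2"
    unfolding d_antihol_wirtinger d_hol_wirtinger
    by (subst wirtinger_has_derivative[OF wirtinger_has_derivative_wirtinger[OF Ck_on_2D(2)[OF Ck_on_hc x]]])
       (simp add: D2 axis_imaginary)
  have s: "g x (axis j 1) (axis i 1) = g x (axis i 1) (axis j 1)"
    "g x (\<i> *s axis j 1) (axis i 1) = g x (axis i 1) (\<i> *s axis j 1)"
    by (rule g_sym[OF x])+
  show ?thesis
    unfolding W2 d_hol_hc[OF x] gij_eq[OF x]
    using hess_type_11[OF x X, where u = "axis j 1" and v = "axis i 1"] hess_type_11[OF x X, where u = "\<i> *s axis j 1" and v = "axis i 1"]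
    by (simp add: complex_eq_iff s linear_neg[OF lin] linear_neg[OF linear_dh[OF x]] field_simps)
qed

section \<open>Conformal change to the Kaehler metric\<close>

lemma gij_conformal: "x \<in> W \<Longrightarrow> gij gt x $ i $ j = of_real (exp (h x)) * gij g x $ i $ j"
  by (simp add: gij_def conformal algebra_simps add_divide_distrib diff_divide_distrib)

lemma d_hol_gij_conformal:
  assumes "x \<in> W"
  shows "d_hol k (\<lambda>x. gij gt x $ i $ j) x =
    of_real (exp (h x)) * (d_hol k (\<lambda>x. gij g x $ i $ j) x + d_hol k hc x * gij g x $ i $ j)"
proof -
  have E: "((\<lambda>x. complex_of_real (exp (h x))) has_derivative (\<lambda>v. of_real (exp (h x) * dh x v))) (at x)"
  proof -
    have "(h has_derivative dh x) (at x)"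
      using Ck_on_2D(1)[OF smooth_h assms] by (simp flip: frechet_derivative_works)
    from has_derivative_exp[OF this] show ?thesis
      by (intro bounded_linear.has_derivative[OF bounded_linear_of_real]) (simp add: mult.commute)
  qed
  have "d_hol k (\<lambda>x. gij gt x $ i $ j) x = d_hol k (\<lambda>x. of_real (exp (h x)) * gij g x $ i $ j) x"
    unfolding d_hol_wirtinger by (rule wirtinger_cong[OF open_W assms]) (rule gij_conformal)
  also have "\<dots> = of_real (exp (h x)) * d_hol k (\<lambda>x. gij g x $ i $ j) x
      + d_hol k (\<lambda>x. of_real (exp (h x))) x * gij g x $ i $ j"
    unfolding d_hol_wirtinger
    using E gij_differentiable[OF assms] by (intro wirtinger_mult) (auto simp: differentiable_def)
  also have "d_hol k (\<lambda>x. complex_of_real (exp (h x))) x = of_real (exp (h x)) * d_hol k hc x"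
    unfolding d_hol_wirtinger wirtinger_has_derivative[OF E]
      wirtinger_has_derivative[OF hc_has_derivative[OF assms]]
    by (simp add: field_simps)
  finally show ?thesis by (simp add: algebra_simps)
qed

text \<open>For the Kaehler condition: differentiating the factor \<open>exp (h x)\<close> adds
  \<open>d_hol k hc x * gij g x $ i $ j\<close>, whose antisymmetrization cancels that of the
  derivatives of \<open>g\<close>.\<close>

sublocale kt: kaehler_on W gt
proof
  show "open W" by (rule open_W)
next
  fix x assume x: "x \<in> W"
  show "bilinear (gt x)"
    using bilin[OF x] unfolding bilinear_def conformal[OF x]
    by (simp add: linear_iff algebra_simps)
  show "gt x u v = gt x v u" for u v by (simp add: conformal[OF x] g_sym[OF x, of u v])
  show "v \<noteq> 0 \<Longrightarrow> gt x v v > 0" for v by (simp add: conformal[OF x] pos[OF x])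
  show "gt x (\<i> *s u) (\<i> *s v) = gt x u v" for u v by (simp add: conformal[OF x] J_inv[OF x])
  show "d_hol k (\<lambda>x. gij gt x $ i $ j) x = d_hol i (\<lambda>x. gij gt x $ k $ j) x" for k i j
    using d_hol_gij_antisym[OF x, of k i j] unfolding d_hol_gij_conformal[OF x]
    by (simp add: algebra_simps)
next
  fix k u v
  have "Ck_on k W (\<lambda>x. exp (h x) * g x u v)"
    by (intro Ck_on_mult Ck_on_exp open_W smooth_h smooth)
  then show "Ck_on k W (\<lambda>x. gt x u v)"
    by (rule Ck_on_cong[OF open_W]) (simp add: conformal)
qed

lemma g_inv_conformal:
  assumes "x \<in> W"
  shows "g_inv gt x $ j $ m = of_real (exp (- h x)) * g_inv g x $ j $ m"
proof -
  have "complex_of_real (exp (h x)) * of_real (exp (- h x)) = 1"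
    by (simp flip: of_real_mult exp_add)
  note e = this
  have "(\<Sum>p\<in>UNIV. gij gt x $ p $ j * (of_real (exp (- h x)) * g_inv g x $ p $ q)) =
      (if j = q then 1 else 0)" for j q
  proof -
    have "(\<Sum>p\<in>UNIV. gij gt x $ p $ j * (of_real (exp (- h x)) * g_inv g x $ p $ q)) =
        (\<Sum>p\<in>UNIV. (of_real (exp (h x)) * of_real (exp (- h x))) * (g_inv g x $ p $ q * gij g x $ p $ j))"
      by (intro sum.cong refl) (simp only: gij_conformal[OF assms] mult_ac)
    then show ?thesis unfolding e by (simp add: g_inv_right[OF assms])
  qed
  then have "transpose (gij gt x) ** (\<chi> j m. of_real (exp (- h x)) * g_inv g x $ j $ m) = mat 1"
    by (simp add: vec_eq_iff matrix_matrix_mult_def transpose_def mat_def)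
  then show ?thesis unfolding g_inv_def by (simp add: matrix_inv_eqI)
qed

lemma chern_Gamma_conformal:
  assumes "x \<in> W"
  shows "chern_Gamma gt k i j x = chern_Gamma g k i j x + (if i = j then d_hol k hc x else 0)"
proof -
  have e: "complex_of_real (exp (- h x)) * of_real (exp (h x)) = 1"
    by (simp flip: of_real_mult exp_add)
  have "chern_Gamma gt k i j x = (\<Sum>m\<in>UNIV. (of_real (exp (- h x)) * of_real (exp (h x))) *
     (g_inv g x $ j $ m * d_hol k (\<lambda>x. gij g x $ i $ m) x +
      d_hol k hc x * (g_inv g x $ j $ m * gij g x $ i $ m)))"
    unfolding chern_Gamma_def g_inv_conformal[OF assms] d_hol_gij_conformal[OF assms]
    by (intro sum.cong refl) (simp add: algebra_simps)
  then show ?thesis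
    unfolding e by (simp add: chern_Gamma_def sum.distrib g_inv_left[OF assms] flip: sum_distrib_left)
qed

text \<open>The Chern connection gains the first derivative of \<open>h\<close> times the identity,
  so the curvature with raised index loses the complex Hessian times the identity. Lowering the
  index with \<open>gt\<close> instead of \<open>g\<close> accounts for the exponential
  factor.\<close>

lemma chern_curvature_conformal:
  assumes "z \<in> W"
  shows "chern_curvature g z i j k l =
    of_real (exp (- h z)) * chern_curvature gt z i j k l + d_antihol j (d_hol i hc) z * gij g z $ k $ l"
proof -
  have d: "d_hol i hc differentiable at z"
    unfolding d_hol_wirtinger by (rule differentiable_wirtinger[OF Ck_on_hc assms])
  have up: "chern_curvature_up gt i j k m z =
     chern_curvature_up g i j k m z - (if k = m then d_antihol j (d_hol i hc) z else 0)" for m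
  proof -
    have "d_antihol j (chern_Gamma gt i k m) z =
       d_antihol j (\<lambda>x. chern_Gamma g i k m x + (if k = m then d_hol i hc x else 0)) z"
      unfolding d_antihol_wirtinger
      by (rule wirtinger_cong[OF open_W assms]) (rule chern_Gamma_conformal)
    then show ?thesis
      using d chern_Gamma_differentiable[OF assms]
      by (simp add: chern_curvature_up_def d_antihol_wirtinger wirtinger_add)
  qed
  have e: "complex_of_real (exp (- h z)) * of_real (exp (h z)) = 1"
    by (simp flip: of_real_mult exp_add)
  have "of_real (exp (- h z)) * chern_curvature gt z i j k l =
      (of_real (exp (- h z)) * of_real (exp (h z))) * (\<Sum>m\<in>UNIV. gij g z $ m $ l *
        (chern_curvature_up g i j k m z - (if k = m then d_antihol j (d_hol i hc) z else 0)))"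
    unfolding chern_curvature_def up gij_conformal[OF assms] sum_distrib_left
    by (intro sum.cong refl) (simp only: mult_ac)
  also have "\<dots> = chern_curvature g z i j k l - d_antihol j (d_hol i hc) z * gij g z $ k $ l"
    unfolding e chern_curvature_def
    by (simp add: right_diff_distrib sum_subtractf if_distrib[of "\<lambda>c. _ * c"] mult.commute cong: if_cong)
  finally show ?thesis by simp
qed

section \<open>The tensor Q in terms of the Kaehler curvature and the potential\<close>

text \<open>Each torsion factor has two terms. In three of the four products the inverse metric
  meets a \<open>gij\<close> and contracts to a Kronecker delta; the fourth leaves the squared norm
  of the holomorphic differential of \<open>h\<close>.\<close>

lemma torsion_square:
  assumes "z \<in> W"
  shows "(\<Sum>p\<in>UNIV. \<Sum>q\<in>UNIV.
      g_inv g z $ p $ q * chern_torsion g k p j z * cnj (chern_torsion g l q i z)) =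
    d_hol k hc z * cnj (d_hol l hc z) * gij g z $ i $ j
    - d_hol k hc z * cnj (d_hol j hc z) * gij g z $ i $ l
    - d_hol i hc z * cnj (d_hol l hc z) * gij g z $ k $ j
    + (\<Sum>p\<in>UNIV. \<Sum>q\<in>UNIV. g_inv g z $ p $ q * d_hol p hc z * cnj (d_hol q hc z))
      * gij g z $ i $ l * gij g z $ k $ j"
proof -
  let ?G = "g_inv g z" and ?g = "gij g z"
  define H where "H k = d_hol k hc z" for k
  have "(\<Sum>p\<in>UNIV. \<Sum>q\<in>UNIV.
      ?G $ p $ q * chern_torsion g k p j z * cnj (chern_torsion g l q i z)) =
    (\<Sum>p\<in>UNIV. \<Sum>q\<in>UNIV. H k * cnj (H l) * ?g $ p $ j * (?G $ p $ q * ?g $ i $ q)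
       - H k * ?g $ i $ l * cnj (H q) * (?G $ p $ q * ?g $ p $ j)
       - cnj (H l) * ?g $ k $ j * H p * (?G $ p $ q * ?g $ i $ q)
       + ?g $ i $ l * ?g $ k $ j * (?G $ p $ q * H p * cnj (H q)))"
    unfolding chern_torsion_eq[OF assms] H_def[symmetric]
    by (intro sum.cong refl) (simp add: gij_cnj[OF assms] algebra_simps)
  also have "\<dots> =
     (\<Sum>p\<in>UNIV. H k * cnj (H l) * ?g $ p $ j * (\<Sum>q\<in>UNIV. ?G $ p $ q * ?g $ i $ q))
     - (\<Sum>q\<in>UNIV. H k * ?g $ i $ l * cnj (H q) * (\<Sum>p\<in>UNIV. ?G $ p $ q * ?g $ p $ j))
     - (\<Sum>p\<in>UNIV. cnj (H l) * ?g $ k $ j * H p * (\<Sum>q\<in>UNIV. ?G $ p $ q * ?g $ i $ q))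
     + ?g $ i $ l * ?g $ k $ j * (\<Sum>p\<in>UNIV. \<Sum>q\<in>UNIV. ?G $ p $ q * H p * cnj (H q))"
  proof -
    \<comment> \<open>Here the delta comes from contraction over \<open>p\<close>, which must become
      the inner index.\<close>
    have "(\<Sum>p\<in>UNIV. \<Sum>q\<in>UNIV. H k * ?g $ i $ l * cnj (H q) * (?G $ p $ q * ?g $ p $ j)) =
      (\<Sum>q\<in>UNIV. \<Sum>p\<in>UNIV. H k * ?g $ i $ l * cnj (H q) * (?G $ p $ q * ?g $ p $ j))"
      by (rule sum.swap)
    then show ?thesis by (simp only: sum.distrib sum_subtractf sum_distrib_left)
  qed
  finally show ?thesis
    by (simp add: g_inv_left[OF assms] g_inv_right[OF assms] if_distrib[of "\<lambda>c. _ * c"] cong: if_cong)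
       (simp add: H_def mult_ac)
qed

lemma gradient_exists: "x \<in> W \<Longrightarrow> \<exists>X. \<forall>w. g x X w = dh x w"
  by (rule bilinear_riesz[OF bilin pos linear_dh])

text \<open>Only the existence of \<open>N\<close> is recorded: its term pairs the slots crosswise
  and vanishes at \<open>m, m, k, k\<close> for distinct frame vectors. The products are arranged to
  match \<open>in_frame_split\<close> and \<open>in_frame_split_swap\<close>.\<close>

lemma Q_tensor_eq:
  assumes z: "z \<in> W" and X: "\<And>w. g z X w = dh z w"
  shows "\<exists>N. \<forall>i j k l. Q_tensor g z i j k l =
    of_real (exp (- h z)) * chern_curvature gt z i j k l
    + (- 1) * ((d_hol i hc z * cnj (d_hol j hc z)) * gij g z $ k $ l)
    + of_real (dh z X / 2) * (gij g z $ i $ j * gij g z $ k $ l)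
    + (- 1) * (gij g z $ i $ j * (d_hol k hc z * cnj (d_hol l hc z)))
    + gij g z $ i $ l * (d_hol k hc z * cnj (d_hol j hc z))
    + (d_hol i hc z * cnj (d_hol l hc z)) * gij g z $ k $ j
    + N * (gij g z $ i $ l * gij g z $ k $ j)"
  unfolding Q_tensor_def torsion_square[OF z] chern_curvature_conformal[OF z] d_antihol_d_hol_hc[OF z X]
  by (rule exI[of _ "- (\<Sum>p\<in>UNIV. \<Sum>q\<in>UNIV. g_inv g z $ p $ q * d_hol p hc z * cnj (d_hol q hc z))"])
     (simp add: algebra_simps)

lemma Q_tensor_in_frame:
  assumes z: "z \<in> W" and X: "\<And>w. g z X w = dh z w"
    and e: "orthonormal_frame g z e" and "m \<noteq> k"
  shows "Re (in_frame (Q_tensor g z) e m m k k) =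
    exp (- h z) * Re (in_frame (chern_curvature gt z) e m m k k) + (dh z X / 2
      - (cmod (\<Sum>i\<in>UNIV. d_hol i hc z * e m $ i))\<^sup>2
      - (cmod (\<Sum>i\<in>UNIV. d_hol i hc z * e k $ i))\<^sup>2)"
proof -
  obtain N where N: "\<And>i j k l. Q_tensor g z i j k l =
    of_real (exp (- h z)) * chern_curvature gt z i j k l
    + (- 1) * ((d_hol i hc z * cnj (d_hol j hc z)) * gij g z $ k $ l)
    + of_real (dh z X / 2) * (gij g z $ i $ j * gij g z $ k $ l)
    + (- 1) * (gij g z $ i $ j * (d_hol k hc z * cnj (d_hol l hc z)))
    + gij g z $ i $ l * (d_hol k hc z * cnj (d_hol j hc z))
    + (d_hol i hc z * cnj (d_hol l hc z)) * gij g z $ k $ j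
    + N * (gij g z $ i $ l * gij g z $ k $ j)"
    using Q_tensor_eq[OF z X] by blast
  have Q: "Q_tensor g z = (\<lambda>i j k l.
    of_real (exp (- h z)) * chern_curvature gt z i j k l
    + (- 1) * ((d_hol i hc z * cnj (d_hol j hc z)) * gij g z $ k $ l)
    + of_real (dh z X / 2) * (gij g z $ i $ j * gij g z $ k $ l)
    + (- 1) * (gij g z $ i $ j * (d_hol k hc z * cnj (d_hol l hc z)))
    + gij g z $ i $ l * (d_hol k hc z * cnj (d_hol j hc z))
    + (d_hol i hc z * cnj (d_hol l hc z)) * gij g z $ k $ j
    + N * (gij g z $ i $ l * gij g z $ k $ j))"
    by (intro ext) (rule N)
  have F1: "(\<Sum>i\<in>UNIV. \<Sum>j\<in>UNIV. gij g z $ i $ j * e a $ i * cnj (e b $ j)) =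
     (if a = b then 1 else 0)" for a b
    using e by (simp add: orthonormal_frame_def)
  have norm: "\<phi> * cnj \<phi> = of_real ((cmod \<phi>)\<^sup>2)" for \<phi>
    by (rule complex_norm_square[symmetric])
  \<comment> \<open>Every crossed product contains a factor pairing \<open>e m\<close> with
    \<open>e k\<close>, which is zero; only the direct products remain.\<close>
  show ?thesis
    unfolding Q in_frame_add in_frame_cmul in_frame_split in_frame_split_swap F1 frame_product norm
    using \<open>m \<noteq> k\<close> by simp
qed

section \<open>Bessel bound in a frame and nonnegativity at a point\<close>

text \<open>The right side is complex linear in \<open>v\<close>, so it suffices to know it on the
  standard basis.\<close>

lemma frame_differential_sum:
  assumes z: "z \<in> W"
  shows "(\<Sum>i\<in>UNIV. d_hol i hc z * v $ i) = (of_real (dh z v) - \<i> * of_real (dh z (\<i> *s v))) / 2"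
proof -
  note L = linear_dh[OF z]
  define F where "F v = (of_real (dh z v) - \<i> * of_real (dh z (\<i> *s v))) / 2" for v
  have lin: "linear F"
    by (intro linearI) (simp_all add: F_def i_mult_add i_mult_scaleR linear_add[OF L] linear_cmul[OF L]
        complex_eq_iff field_simps)
  have J: "F (\<i> *s v) = \<i> * F v" for v
    by (simp add: F_def linear_neg[OF L] complex_eq_iff)
  have s: "F (c *s v) = c * F v" for c v
    by (subst scalar_mult_complex_vec) (simp add: linear_add[OF lin] linear_cmul[OF lin] J complex_eq_iff)
  have "F v = F (\<Sum>i\<in>UNIV. v $ i *s axis i 1)" by (simp add: basis_expansion)
  also have "\<dots> = (\<Sum>i\<in>UNIV. d_hol i hc z * v $ i)"
    by (simp add: linear_sum[OF lin] s d_hol_hc[OF z] F_def[symmetric] mult.commute)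
  finally show ?thesis by (simp add: F_def)
qed

text \<open>Bessel's inequality for the gradient \<open>X\<close>, whose products with the frame
  vectors are the values of \<open>dh\<close>. The squared moduli carry a factor 1/4, which turns
  the bound \<open>2 * dh z X\<close> into \<open>dh z X / 2\<close>.\<close>

lemma frame_differential_bound:
  assumes z: "z \<in> W" and X: "\<And>w. g z X w = dh z w"
    and e: "orthonormal_frame g z e" and "m \<noteq> k"
  shows "(cmod (\<Sum>i\<in>UNIV. d_hol i hc z * e m $ i))\<^sup>2
      + (cmod (\<Sum>i\<in>UNIV. d_hol i hc z * e k $ i))\<^sup>2 \<le> dh z X / 2"
proof -
  have o: "(complex_of_real (g z (e a) (e b)) + \<i> * of_real (g z (e a) (\<i> *s e b))) / 2 =
     (if a = b then 1 else 0)" for a b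
    using e by (simp add: orthonormal_frame_def gij_sesquilinear[OF z])
  have o1: "g z (e a) (e a) = 2" "g z (e a) (\<i> *s e a) = 0" for a
    using o[of a a] by (simp_all add: complex_eq_iff)
  have o2: "g z (e m) (e k) = 0" "g z (e m) (\<i> *s e k) = 0"
    using o[of m k] \<open>m \<noteq> k\<close> by (simp_all add: complex_eq_iff)
  have bound: "(dh z (e m))\<^sup>2 + (dh z (\<i> *s e m))\<^sup>2 + (dh z (e k))\<^sup>2 + (dh z (\<i> *s e k))\<^sup>2 \<le> 2 * dh z X"
    using bessel_two_complex_vectors[OF bilin[OF z] g_sym[OF z] pos[OF z] J_inv[OF z] o1 o1 o2, of X]
    by (simp add: X)
  have sq: "(cmod (\<Sum>i\<in>UNIV. d_hol i hc z * v $ i))\<^sup>2 = ((dh z v)\<^sup>2 + (dh z (\<i> *s v))\<^sup>2) / 4" for v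
    unfolding frame_differential_sum[OF z] cmod_power2 by (simp add: power_divide add_divide_distrib)
  show ?thesis unfolding sq using bound by argo
qed

lemma Q_nonnegative_at:
  assumes z: "z \<in> W" and e: "orthonormal_frame g z e"
    and qob: "\<And>e l. orthonormal_frame gt z e \<Longrightarrow> (\<Sum>k\<in>UNIV. \<Sum>m\<in>UNIV.
      Re (in_frame (chern_curvature gt z) e m m k k) * (l k - l m)\<^sup>2) \<ge> 0"
  shows "(\<Sum>k\<in>UNIV. \<Sum>m\<in>UNIV.
    Re (in_frame (Q_tensor g z) e m m k k) * ((l k)\<^sup>2 - l k * l m)) \<ge> 0"
proof -
  obtain X where X: "\<And>w. g z X w = dh z w" using gradient_exists[OF z] by blast
  define R where "R m k = Re (in_frame (chern_curvature gt z) e m m k k)" for m k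
  \<comment> \<open>Scaling by this factor turns a frame orthonormal for \<open>g\<close> into one
    orthonormal for \<open>gt\<close>.\<close>
  define r where "r = exp (- h z / 2)"
  have r: "r > 0" "exp (h z) * (r * r) = 1"
    unfolding r_def by (simp_all flip: exp_add)
  have rc: "complex_of_real (exp (h z)) * (of_real r * of_real r) = 1"
    unfolding of_real_mult[symmetric] r(2) by simp
  have "orthonormal_frame gt z (\<lambda>a. of_real r *s e a)"
  proof -
    have "(\<Sum>i\<in>UNIV. \<Sum>j\<in>UNIV. gij gt z $ i $ j * (of_real r *s e a) $ i * cnj ((of_real r *s e b) $ j)) =
      (\<Sum>i\<in>UNIV. \<Sum>j\<in>UNIV. (of_real (exp (h z)) * (of_real r * of_real r)) * (gij g z $ i $ j * e a $ i * cnj (e b $ j)))" for a b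
      by (intro sum.cong refl) (simp add: gij_conformal[OF z] mult_ac)
    then show ?thesis using e unfolding rc orthonormal_frame_def by simp
  qed
  from qob[OF this, of l] have "0 \<le> r ^ 4 * (\<Sum>k\<in>UNIV. \<Sum>m\<in>UNIV. R m k * (l k - l m)\<^sup>2)"
    unfolding in_frame_scale R_def sum_distrib_left by (simp add: mult_ac flip: of_real_power)
  then have R0: "0 \<le> (\<Sum>k\<in>UNIV. \<Sum>m\<in>UNIV. R m k * (l k - l m)\<^sup>2)"
    using r(1) by (simp add: zero_le_mult_iff)
  define b where "b m k = (if m = k then 0 else dh z X / 2
      - (cmod (\<Sum>i\<in>UNIV. d_hol i hc z * e m $ i))\<^sup>2
      - (cmod (\<Sum>i\<in>UNIV. d_hol i hc z * e k $ i))\<^sup>2)" for m k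
  have b0: "0 \<le> b m k" for m k
  proof (cases "m = k")
    case True
    then show ?thesis by (simp add: b_def)
  next
    case False
    from frame_differential_bound[OF z X e this] show ?thesis by (simp only: b_def False if_False)
  qed
  \<comment> \<open>The curvature part is symmetric by the Kaehler symmetries of \<open>gt\<close>,
    the part \<open>b\<close> by its form.\<close>
  have sym: "exp (- h z) * R m k + b m k = exp (- h z) * R k m + b k m" for m k
    unfolding R_def b_def
    using in_frame_swap_pairs[of "chern_curvature gt z" e m k]
      kt.chern_curvature_swap_hol[OF z] kt.chern_curvature_swap_antihol[OF z] by simp
  have "(\<Sum>k\<in>UNIV. \<Sum>m\<in>UNIV.
      Re (in_frame (Q_tensor g z) e m m k k) * ((l k)\<^sup>2 - l k * l m)) =
    (\<Sum>k\<in>UNIV. \<Sum>m\<in>UNIV. (exp (- h z) * R m k + b m k) * ((l k)\<^sup>2 - l k * l m))"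
  proof (intro sum.cong refl)
    fix k m
    show "Re (in_frame (Q_tensor g z) e m m k k) * ((l k)\<^sup>2 - l k * l m) =
      (exp (- h z) * R m k + b m k) * ((l k)\<^sup>2 - l k * l m)"
    proof (cases "m = k")
      case True
      then show ?thesis by (simp add: power2_eq_square)
    next
      case False
      then show ?thesis by (simp only: Q_tensor_in_frame[OF z X e False] R_def b_def if_False)
    qed
  qed
  also have "\<dots> = (\<Sum>k\<in>UNIV. \<Sum>m\<in>UNIV. (exp (- h z) * R m k + b m k) * (l k - l m)\<^sup>2) / 2"
    by (rule sum_sq_diff_symmetric) (rule sym)
  also have "\<dots> = (exp (- h z) * (\<Sum>k\<in>UNIV. \<Sum>m\<in>UNIV. R m k * (l k - l m)\<^sup>2)
      + (\<Sum>k\<in>UNIV. \<Sum>m\<in>UNIV. b m k * (l k - l m)\<^sup>2)) / 2"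
    by (simp add: distrib_right sum.distrib sum_distrib_left mult.assoc)
  also have "\<dots> \<ge> 0"
  proof -
    have "0 \<le> (\<Sum>k\<in>UNIV. \<Sum>m\<in>UNIV. b m k * (l k - l m)\<^sup>2)"
      using b0 by (intro sum_nonneg mult_nonneg_nonneg) auto
    then show ?thesis using R0 by simp
  qed
  finally show ?thesis .
qed

end

section \<open>Charts of the cover\<close>

lemma Ck_on_subset: "Ck_on k S f \<Longrightarrow> W \<subseteq> S \<Longrightarrow> Ck_on k W f"
  by (induction k arbitrary: f) (auto intro: continuous_on_subset)

text \<open>A sheet over an evenly covered neighbourhood, cut down to the preimage of the chart
  domain, carries the coordinates \<open>snd c \<circ> p\<close>. In these and the coordinates
  \<open>c\<close> the projection is the identity.\<close>

lemma cover_chart_lifting: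
  fixes M :: "'a::{t2_space, second_countable_topology} set"
    and A :: "('a, 'n::finite) chart set"
    and E :: "'b::topological_space set"
  assumes M: "complex_manifold M A" and cov: "covering_space E p M"
    and c: "c \<in> A" and z: "z \<in> chart_img c"
  obtains d where "d \<in> cover_atlas A E p" "z \<in> chart_img d" "open (chart_img d)"
    "chart_img d \<subseteq> chart_img c"
    "\<And>w. w \<in> chart_img d \<Longrightarrow> p (chart_inv d w) = chart_inv c w"
    "\<And>w. w \<in> chart_img d \<Longrightarrow> chart_inv c w \<in> chart_dom c"
    "\<And>w. w \<in> chart_img d \<Longrightarrow> snd c (chart_inv c w) = w"
proof -
  have op: "openin (top_of_set M) (chart_dom c)" "open (chart_img c)"
    and hom: "homeomorphism (chart_dom c) (chart_img c) (snd c) (chart_inv c)"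
    using M c by (auto simp: complex_manifold_def)
  have inv: "chart_inv c (snd c x) = x" if "x \<in> chart_dom c" for x
    using hom that by (auto simp: homeomorphism_def)
  obtain x where x: "x \<in> chart_dom c" "z = snd c x" using z by (auto simp: chart_img_def)
  have "x \<in> M" using op(1) x(1) openin_imp_subset by blast
  then obtain T vs where T: "x \<in> T" "openin (top_of_set M) T" "\<Union>vs = E \<inter> p -` T"
    and vs: "\<And>u. u \<in> vs \<Longrightarrow> openin (top_of_set E) u" "\<And>u. u \<in> vs \<Longrightarrow> \<exists>q. homeomorphism u T p q"
    using cov unfolding covering_space_def by metis
  obtain y where y: "y \<in> E" "p y = x" using cov \<open>x \<in> M\<close> by (auto simp: covering_space_def)
  \<comment> \<open>The sheet over \<open>T\<close> through a chosen preimage of the given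
    point.\<close>
  then obtain u where u: "u \<in> vs" "y \<in> u" using T by blast
  obtain q where q: "homeomorphism u T p q" using vs(2)[OF u(1)] by blast
  have inj: "inj_on p u" and pu: "p ` u = T"
    using q by (auto simp: homeomorphism_def intro: inj_on_inverseI)
  define V where "V = u \<inter> (E \<inter> p -` chart_dom c)"
  have "u \<subseteq> E" using vs(1)[OF u(1)] openin_imp_subset by blast
  then have pV: "p ` V = T \<inter> chart_dom c" using pu by (auto simp: V_def)
  have "openin (top_of_set E) (E \<inter> p -` chart_dom c)"
    using cov op(1) by (intro continuous_openin_preimage[of E p M]) (auto simp: covering_space_def)
  then have openV: "openin (top_of_set E) V"
    unfolding V_def by (rule openin_Int[OF vs(1)[OF u(1)]])
  define d where "d = (V, snd c \<circ> p)"
  have img: "chart_img d = snd c ` (T \<inter> chart_dom c)"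
    by (simp only: d_def chart_img_def fst_conv snd_conv image_comp[symmetric] pV)
  have "d \<in> cover_atlas A E p"
  proof -
    have "inj_on p V" using inj by (rule inj_on_subset) (auto simp: V_def)
    moreover have "p ` V \<subseteq> chart_dom c" using pV by blast
    ultimately show ?thesis unfolding cover_atlas_def d_def using c openV by blast
  qed
  moreover have "z \<in> chart_img d" unfolding img using x T(1) by blast
  moreover have "open (chart_img d)"
  proof -
    have "openin (top_of_set (chart_dom c)) (T \<inter> chart_dom c)"
      using openin_subset_trans[OF openin_Int[OF T(2) op(1)]] openin_imp_subset[OF op(1)] by blast
    then show ?thesis
      unfolding img using homeomorphism_imp_open_map[OF hom] op(2) openin_open_trans by blast
  qed
  moreover have "chart_img d \<subseteq> chart_img c" unfolding img by (auto simp: chart_img_def)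
  moreover have "p (chart_inv d w) = chart_inv c w" if "w \<in> chart_img d" for w
  proof -
    have w: "w \<in> (snd c \<circ> p) ` V" using that by (simp add: d_def chart_img_def)
    have "chart_inv d w \<in> V" "snd c (p (chart_inv d w)) = w"
      using inv_into_into[OF w] f_inv_into_f[OF w] by (simp_all add: chart_inv_def d_def)
    then show ?thesis using inv[of "p (chart_inv d w)"] by (auto simp: V_def)
  qed
  moreover have "chart_inv c w \<in> chart_dom c" "snd c (chart_inv c w) = w" if "w \<in> chart_img d" for w
    using that inv by (auto simp: img)
  ultimately show ?thesis by (rule that)
qed

section \<open>Pullbacks in a lifted chart\<close>

locale lifted_chart =
  fixes A :: "('a, 'n::finite) chart set" and p :: "'b \<Rightarrow> 'a"
    and c :: "('a, 'n) chart" and d :: "('b, 'n) chart"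
  assumes c: "c \<in> A" and open_img: "open (chart_img d)"
    and proj: "w \<in> chart_img d \<Longrightarrow> p (chart_inv d w) = chart_inv c w"
    and in_dom: "w \<in> chart_img d \<Longrightarrow> chart_inv c w \<in> chart_dom c"
    and inv: "w \<in> chart_img d \<Longrightarrow> snd c (chart_inv c w) = w"
begin

text \<open>The choice made by \<open>target_chart\<close> may differ from \<open>c\<close>;
  \<open>c\<close> only witnesses that a choice exists.\<close>

lemma target_chart:
  assumes "w \<in> chart_img d"
  shows "target_chart A p d w \<in> A"
    "w \<in> snd c ` (chart_dom c \<inter> chart_dom (target_chart A p d w))"
proof -
  have "target_chart A p d w \<in> A \<and> p (chart_inv d w) \<in> chart_dom (target_chart A p d w)"
    unfolding target_chart_def by (rule someI[of _ c]) (simp add: c proj[OF assms] in_dom[OF assms])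
  then show "target_chart A p d w \<in> A"
    "w \<in> snd c ` (chart_dom c \<inter> chart_dom (target_chart A p d w))"
    using in_dom[OF assms] inv[OF assms] proj[OF assms] by (auto simp: image_iff intro!: bexI[of _ "chart_inv c w"])
qed

lemma local_expression:
  assumes "w \<in> chart_img d"
  shows "(snd c' \<circ> p \<circ> chart_inv d) w = transition c c' w"
    "frechet_derivative (snd c' \<circ> p \<circ> chart_inv d) (at w) = frechet_derivative (transition c c') (at w)"
  using assms
  by (auto intro!: frechet_derivative_cong_open[OF open_img] simp: transition_def proj)

text \<open>The local expression of \<open>p\<close> is the coordinate change from \<open>c\<close>
  to the chosen target chart, so the transformation law of the tensor returns its components in
  \<open>c\<close>. The same holds for the metric below.\<close>

lemma pullback1_lifted:
  assumes "one_form A \<theta>" "w \<in> chart_img d"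
  shows "pullback1 A p \<theta> d w v = \<theta> c w v"
  using assms(1) c target_chart[OF assms(2)]
  unfolding pullback1_def Let_def local_expression[OF assms(2)] one_form_def by metis

lemma pullback2_lifted:
  assumes "hermitian_metric A g" "w \<in> chart_img d"
  shows "pullback2 A p g d w u v = g c w u v"
  using assms(1) c target_chart[OF assms(2)]
  unfolding pullback2_def Let_def local_expression[OF assms(2)] hermitian_metric_def by metis

end

section \<open>From the local computation to the manifold\<close>

theorem theorem4p6:
  fixes M :: "'a::{t2_space, second_countable_topology} set"
    and A :: "('a, 'n::finite) chart set"
    and g :: "('a, 'n) chart \<Rightarrow> 'n form2"
    and \<theta> :: "('a, 'n) chart \<Rightarrow> 'n form1"
    and E :: "'b::topological_space set"
    and p :: "'b \<Rightarrow> 'a"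
    and f :: "'b \<Rightarrow> real"
  assumes "Vaisman M A g \<theta>"
    and "kaehler_cyclic_cover M A \<theta> E p f"
    and "nonneg_quadratic_orth_bisectional (cover_atlas A E p) (kaehler_cover_metric A g p f)"
  shows "Q_nonnegative A g"
  unfolding Q_nonnegative_def
proof (intro ballI allI impI)
  fix c z e and l :: "'n \<Rightarrow> real"
  assume c: "c \<in> A" and z: "z \<in> chart_img c" and e: "orthonormal_frame (g c) z e"
  have M: "complex_manifold M A" and g: "hermitian_metric A g" and \<theta>: "one_form A \<theta>"
    and lck: "LCK M A g \<theta>"
    using assms(1) by (auto simp: Vaisman_def LCK_def hermitian_manifold_def)
  have cov: "covering_space E p M" using assms(2) by (simp add: kaehler_cyclic_cover_def)
  obtain d where d: "d \<in> cover_atlas A E p" "z \<in> chart_img d" "open (chart_img d)"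
    and sub: "chart_img d \<subseteq> chart_img c"
    and lift: "\<And>w. w \<in> chart_img d \<Longrightarrow> p (chart_inv d w) = chart_inv c w"
    "\<And>w. w \<in> chart_img d \<Longrightarrow> chart_inv c w \<in> chart_dom c"
    "\<And>w. w \<in> chart_img d \<Longrightarrow> snd c (chart_inv c w) = w"
    by (rule cover_chart_lifting[OF M cov c z]) (rule that)
  interpret lifted_chart A p c d
    by unfold_locales (use c d lift in auto)
  \<comment> \<open>Metric and Lee form are taken in the chart \<open>c\<close> of \<open>M\<close>,
    potential and Kaehler metric in the chart \<open>d\<close> of the cover. All live on
    \<open>chart_img d\<close>, because \<open>p\<close> is the identity in these
    coordinates.\<close>
  interpret local_vaisman "chart_img d" "g c" "kaehler_cover_metric A g p f d" "\<theta> c" "f \<circ> chart_inv d"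
  proof
    show "open (chart_img d)" by (rule d(3))
  next
    fix x assume x: "x \<in> chart_img d"
    then have xc: "x \<in> chart_img c" using sub by blast
    show "bilinear (g c x)" "g c x u v = g c x v u" "v \<noteq> 0 \<Longrightarrow> 0 < g c x v v"
      "g c x (\<i> *s u) (\<i> *s v) = g c x u v" for u v
      using g c xc unfolding hermitian_metric_def by blast+
    show "\<theta> c x v = - frechet_derivative (f \<circ> chart_inv d) (at x) v" for v
      using assms(2) d(1) x pullback1_lifted[OF \<theta> x] unfolding kaehler_cyclic_cover_def by metis
    show "ext_deriv2 (fundamental_form (g c)) x u v w = wedge12 (\<theta> c) (fundamental_form (g c)) x u v w" for u v w
      using lck c xc unfolding LCK_def by blast
    show "nabla_LC (g c) (\<theta> c) x u v = 0" for u v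
      using assms(1) c xc unfolding Vaisman_def by blast
    show "\<exists>!\<Gamma>. torsion_free_metric_at (g c) x \<Gamma>"
      by (rule levi_civita_ex1[OF M g c xc])
    show "kaehler_cover_metric A g p f d x u v = exp ((f \<circ> chart_inv d) x) * g c x u v" for u v
      by (simp add: kaehler_cover_metric_def pullback2_lifted[OF g x])
  next
    fix k u v
    show "Ck_on k (chart_img d) (\<lambda>x. g c x u v)"
      using g c sub by (intro Ck_on_subset[OF _ sub]) (auto simp: hermitian_metric_def smooth_on_def)
    show "Ck_on k (chart_img d) (f \<circ> chart_inv d)"
      using assms(2) d(1) by (simp add: kaehler_cyclic_cover_def smooth_on_def)
  qed
  show "0 \<le> (\<Sum>k\<in>UNIV. \<Sum>m\<in>UNIV.
      Re (in_frame (Q_tensor (g c) z) e m m k k) * ((l k)\<^sup>2 - l k * l m))"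
    using assms(3) d(1,2) by (intro Q_nonnegative_at[OF d(2) e]) (auto simp: nonneg_quadratic_orth_bisectional_def)
qed

end
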